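(* Let $\tilde P_j^m$ and $\tilde P_{j'}^{m'}$ be $h$-symplecton. Then they obey the product law $$\tilde P_j^m\,\tilde P_{j'}^{m'}=\sum_{k=|j-j'|}^{j+j'}\ \sum_{n,n'}\ \langle k|j|j'\rangle\,(F^{-1})^{j,j'}_{n,n';\,m,m'}\;C^{j',\,j,\,k}_{n',\,m,\,n'+m}\;\tilde P_k^{\,n'+m},$$ where $n$ runs over $-j,\dots,j$, $n'$ runs over $-j',\dots,j'$, $C^{j_1,j_2,j}_{m_1,m_2,m}$ is the Clebsch–Gordan coefficient of $sl(2)$, and $$\langle k|j|j'\rangle=2^{k-j-j'}(2k+1)^{-1/2}\,\nabla(kjj'),\qquad \nabla(abc)=\left[\frac{(a+b+c+1)!}{(a+b-c)!\,(a-b+c)!\,(-a+b+c)!}\right]^{1/2}.$$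
   Context: Let $a,\bar a$ be boson operators with $[\bar a,a]=1$, $h$ the deformation parameter, and $\sigma=-\ln(1+ha^2)$ (understood as a power series). The $sl(2)$ symplecton is the polynomial $$P_j^m(a,\bar a)=\frac{1}{2^{j-m}}\left[\frac{(2j)!\,(j-m)!}{(j+m)!}\right]^{1/2}\sum_{s=0}^{j-m}\frac{\bar a^{\,j-m-s}a^{j+m}\bar a^{\,s}}{s!\,(j-m-s)!},\qquad j\in\{0,\tfrac12,1,\dots\},\ m\in\{-j,\dots,j\}$$ (so that $P_j^j=a^{2j}$), and the $h$-symplecton is $\tilde P_j^m=P_j^m(a,\bar a)\,e^{m\sigma}$. Terms with $|n'+m|>k$ are zero (the Clebsch–Gordan coefficient vanishes). The spin-$j$ representation of the Jordanian quantum algebra $\mathcal U_h(sl(2))$ is the usual one of $sl(2)$: generators $J_\pm,J_0$ with $[J_0,J_\pm]=\pm2J_\pm$, $[J_+,J_-]=J_0$, orthonormal basis $|j\,m\rangle$, $-j\le m\le j$, $J_\pm|j\,m\rangle=\sqrt{(j\mp m)(j\pm m+1)}\,|j\,m\pm1\rangle$, $J_0|j\,m\rangle=2m|j\,m\rangle$. The twist element is $\mathcal F=\exp(-\tfrac12J_0\otimes\sigma)$ with $\sigma=-\ln(1-2hJ_+)$ (in the boson realization $J_+=-\tfrac12a^2$, which gives the $\sigma$ above), and $$(F^{-1})^{j,j'}_{n,n';\,m,m'}=\langle j\,n|\otimes\langle j'\,n'|\;\mathcal F^{-1}\;|j\,m\rangle\otimes|j'\,m'\rangle .$$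
   Formalization: The right side carries an extra factor [(2j)!(2j')!/(2k)!]^{1/2} in each term; with P_j^j = a^{2j} the printed law fails (j=j'=m=m'=1/2 gives a²e^σ on the left, √2 a²e^σ on the right). *)

theory Defs
  imports "HOL-Computational_Algebra.Formal_Power_Series"
begin

unbundle fps_syntax

text \<open>Spins and weights are real numbers; \<open>j\<close> is a spin if \<open>2 * j \<in> \<nat>\<close>.
  The deformation parameter \<open>h\<close> is formal: it is \<^const>\<open>fps_X\<close>, which is central in \<open>'w fps\<close>
  also when \<open>'w\<close> is noncommutative.\<close>

definition weights :: "real \<Rightarrow> real set" where
  "weights j = {m. j - m \<in> \<nat> \<and> j + m \<in> \<nat>}"

text \<open>Factorial of a real number that is a natural number.\<close>

definition rfact :: "real \<Rightarrow> real" where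
  "rfact x = fact (nat \<lfloor>x\<rfloor>)"

definition of_real_fps :: "real fps \<Rightarrow> 'w::real_algebra_1 fps" where
  "of_real_fps f = Abs_fps (\<lambda>n. of_real (f $ n))"

subsection \<open>The symplecton\<close>

text \<open>\<open>sigma_boson a\<close> is \<open>- ln (1 + h a\<^sup>2)\<close>: the series \<^term>\<open>fps_ln 1\<close> is \<open>ln (1 + X)\<close>, and
  \<^term>\<open>fps_exp m\<close> below is \<open>exp (m X)\<close>; both are composed with series without constant term.\<close>

definition sigma_boson :: "'w::real_algebra_1 \<Rightarrow> 'w fps" where
  "sigma_boson a = - (of_real_fps (fps_ln 1) oo (fps_X * fps_const (a ^ 2)))"

definition symplecton :: "'w::real_algebra_1 \<Rightarrow> 'w \<Rightarrow> real \<Rightarrow> real \<Rightarrow> 'w" where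
  "symplecton a abar j m =
     (let p = nat \<lfloor>j - m\<rfloor>; q = nat \<lfloor>j + m\<rfloor> in
      (1 / 2 powr (j - m) * sqrt (rfact (2 * j) * rfact (j - m) / rfact (j + m))) *\<^sub>R
      (\<Sum>s = 0..p. (1 / (fact s * fact (p - s))) *\<^sub>R (abar ^ (p - s) * a ^ q * abar ^ s)))"

definition h_symplecton :: "'w::real_algebra_1 \<Rightarrow> 'w \<Rightarrow> real \<Rightarrow> real \<Rightarrow> 'w fps" where
  "h_symplecton a abar j m =
     fps_const (symplecton a abar j m) * (of_real_fps (fps_exp m) oo sigma_boson a)"

subsection \<open>The spin-\<open>j\<close> representation\<close>

text \<open>Operators are given by their matrices in the orthonormal basis, \<open>A n m = \<langle>j n|A|j m\<rangle>\<close>,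
  with entries \<open>0\<close> outside the index set.\<close>

definition J_plus :: "real \<Rightarrow> real \<Rightarrow> real \<Rightarrow> real" where
  "J_plus j n m = (if m \<in> weights j \<and> n \<in> weights j \<and> n = m + 1
                   then sqrt ((j - m) * (j + m + 1)) else 0)"

definition J_minus :: "real \<Rightarrow> real \<Rightarrow> real \<Rightarrow> real" where
  "J_minus j n m = (if m \<in> weights j \<and> n \<in> weights j \<and> n = m - 1
                    then sqrt ((j + m) * (j - m + 1)) else 0)"

definition J_zero :: "real \<Rightarrow> real \<Rightarrow> real \<Rightarrow> real" where
  "J_zero j n m = (if m \<in> weights j \<and> n = m then 2 * m else 0)"

subsection \<open>Clebsch-Gordan coefficients of \<open>sl(2)\<close>\<close>

text \<open>A vector \<open>\<Sum> v (m1, m2) |j1 m1\<rangle> \<otimes> |j2 m2\<rangle>\<close> is represented by its coefficients \<open>v\<close>;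
  \<open>cop_act\<close> gives the action of \<open>J \<otimes> 1 + 1 \<otimes> J\<close>.\<close>

definition cop_act :: "(real \<Rightarrow> real \<Rightarrow> real \<Rightarrow> real) \<Rightarrow> real \<Rightarrow> real
    \<Rightarrow> (real \<times> real \<Rightarrow> real) \<Rightarrow> (real \<times> real \<Rightarrow> real)" where
  "cop_act J j1 j2 v = (\<lambda>(n1, n2).
     (\<Sum>m1\<in>weights j1. J j1 n1 m1 * v (m1, n2)) + (\<Sum>m2\<in>weights j2. J j2 n2 m2 * v (n1, m2)))"

text \<open>The highest weight unit vector \<open>|k k\<rangle>\<close> of the spin-\<open>k\<close> component of the tensor product,
  with the Condon-Shortley phase \<open>\<langle>j1 j1; j2 (k - j1)|k k\<rangle> > 0\<close>.\<close>

definition cg_highest :: "real \<Rightarrow> real \<Rightarrow> real \<Rightarrow> (real \<times> real \<Rightarrow> real)" where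
  "cg_highest j1 j2 k = (THE v.
     (\<forall>m1 m2. v (m1, m2) \<noteq> 0 \<longrightarrow> m1 \<in> weights j1 \<and> m2 \<in> weights j2) \<and>
     cop_act J_zero j1 j2 v = (\<lambda>p. 2 * k * v p) \<and>
     cop_act J_plus j1 j2 v = (\<lambda>p. 0) \<and>
     (\<Sum>p\<in>weights j1 \<times> weights j2. (v p)\<^sup>2) = 1 \<and>
     v (j1, k - j1) > 0)"

text \<open>\<open>clebsch_gordan j1 j2 k m1 m2 m\<close> is \<open>\<langle>j1 m1; j2 m2|k m\<rangle>\<close>, where
  \<open>|k m\<rangle> = ((k + m)! / ((2k)! (k - m)!))\<^bsup>1/2\<^esup> J\<^sub>-\<^bsup>k-m\<^esup> |k k\<rangle>\<close>, as forced by
  \<open>J\<^sub>- |k m\<rangle> = ((k + m) (k - m + 1))\<^bsup>1/2\<^esup> |k (m - 1)\<rangle>\<close>.\<close>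

definition clebsch_gordan :: "real \<Rightarrow> real \<Rightarrow> real \<Rightarrow> real \<Rightarrow> real \<Rightarrow> real \<Rightarrow> real" where
  "clebsch_gordan j1 j2 k m1 m2 m =
     (if k - \<bar>j1 - j2\<bar> \<in> \<nat> \<and> j1 + j2 - k \<in> \<nat> \<and> m \<in> weights k
      then sqrt (rfact (k + m) / (rfact (2 * k) * rfact (k - m))) *
           ((cop_act J_minus j1 j2 ^^ nat \<lfloor>k - m\<rfloor>) (cg_highest j1 j2 k)) (m1, m2)
      else 0)"

subsection \<open>The twist element\<close>

text \<open>Matrices over \<open>\<real>[[h]]\<close> with rows and columns indexed by a finite set \<open>I\<close>.\<close>

type_synonym 'i hmat = "'i \<Rightarrow> 'i \<Rightarrow> real fps"

definition hmat_one :: "'i set \<Rightarrow> 'i hmat" where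
  "hmat_one I = (\<lambda>x y. if x \<in> I \<and> x = y then 1 else 0)"

definition hmat_mult :: "'i set \<Rightarrow> 'i hmat \<Rightarrow> 'i hmat \<Rightarrow> 'i hmat" where
  "hmat_mult I A B = (\<lambda>x y. \<Sum>z\<in>I. A x z * B z y)"

primrec hmat_power :: "'i set \<Rightarrow> 'i hmat \<Rightarrow> nat \<Rightarrow> 'i hmat" where
  "hmat_power I A 0 = hmat_one I"
| "hmat_power I A (Suc k) = hmat_mult I A (hmat_power I A k)"

text \<open>The power series \<open>\<Sum>\<^sub>k f\<^sub>k A\<^sup>k\<close> in a matrix \<open>A\<close> all of whose entries are divisible by \<open>h\<close>,
  so that only the terms with \<open>k \<le> n\<close> contribute to the coefficient of \<open>h\<^sup>n\<close>
  (cf. \<^const>\<open>fps_compose\<close>).\<close>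

definition hmat_compose :: "'i set \<Rightarrow> real fps \<Rightarrow> 'i hmat \<Rightarrow> 'i hmat" where
  "hmat_compose I f A = (\<lambda>x y. Abs_fps (\<lambda>n. \<Sum>k = 0..n. f $ k * (hmat_power I A k x y $ n)))"

definition hmat_inverse :: "'i set \<Rightarrow> 'i hmat \<Rightarrow> 'i hmat" where
  "hmat_inverse I A = (THE B. (\<forall>x y. B x y \<noteq> 0 \<longrightarrow> x \<in> I \<and> y \<in> I) \<and>
     hmat_mult I A B = hmat_one I \<and> hmat_mult I B A = hmat_one I)"

definition hmat_tensor :: "'i hmat \<Rightarrow> 'k hmat \<Rightarrow> ('i \<times> 'k) hmat" where
  "hmat_tensor A B = (\<lambda>(n, n') (m, m'). A n m * B n' m')"

text \<open>\<open>- ln (1 - 2 h J\<^sub>+)\<close> in the spin-\<open>j\<close> representation.\<close>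

definition sigma_spin :: "real \<Rightarrow> real hmat" where
  "sigma_spin j = (\<lambda>n m.
     - hmat_compose (weights j) (fps_ln 1) (\<lambda>x y. - 2 * fps_X * fps_const (J_plus j x y)) n m)"

definition twist :: "real \<Rightarrow> real \<Rightarrow> (real \<times> real) hmat" where
  "twist j j' = hmat_compose (weights j \<times> weights j') (fps_exp 1)
     (\<lambda>x y. fps_const (- 1 / 2) *
        hmat_tensor (\<lambda>n m. fps_const (J_zero j n m)) (sigma_spin j') x y)"

definition twist_inv :: "real \<Rightarrow> real \<Rightarrow> real \<Rightarrow> real \<Rightarrow> real \<Rightarrow> real \<Rightarrow> real fps" where
  "twist_inv j j' n n' m m' =
     hmat_inverse (weights j \<times> weights j') (twist j j') (n, n') (m, m')"

subsection \<open>The reduced coefficient\<close>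

definition nabla :: "real \<Rightarrow> real \<Rightarrow> real \<Rightarrow> real" where
  "nabla a b c = sqrt (rfact (a + b + c + 1) /
     (rfact (a + b - c) * rfact (a - b + c) * rfact (- a + b + c)))"

text \<open>This is the coefficient of the product law for symplectons normalized by
  \<open>P\<^sub>j\<^sup>j = a\<^bsup>2j\<^esup> / ((2j)!)\<^bsup>1/2\<^esup>\<close>. With the normalization \<open>P\<^sub>j\<^sup>j = a\<^bsup>2j\<^esup>\<close> of
  \<^const>\<open>symplecton\<close> it has to be multiplied by \<open>((2j)! (2j')! / (2k)!)\<^bsup>1/2\<^esup>\<close>.\<close>

definition reduced_coeff :: "real \<Rightarrow> real \<Rightarrow> real \<Rightarrow> real" where
  "reduced_coeff k j j' = 2 powr (k - j - j') * (2 * k + 1) powr (- 1 / 2) * nabla k j j'"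

end

theory Submission
  imports Defs
begin

text \<open>Up to a factor, \<open>P\<^sub>j\<^sup>m\<close> is the Weyl ordered monomial \<open>a\<^bsup>j+m\<^esup> abar\<^bsup>j-m\<^esup>\<close>. Hence products of
  symplectons are given by the Moyal formula, and the coefficient of \<open>P\<^sub>k\<^bsup>m+m'\<^esup>\<close> in
  \<open>P\<^sub>j\<^sup>m P\<^sub>j\<^sub>'\<^bsup>m'\<^esup>\<close> is an alternating sum that turns out to be Racah's sum for the Clebsch-Gordan
  coefficient. The latter is identified by showing that Racah's sums form a highest weight vector,
  are compatible with \<open>J\<^sub>-\<close>, and have the right norm (a Vandermonde convolution).
  For the deformed product, \<open>e\<^bsup>m \<sigma>\<^esup> = (1 + h a\<^sup>2)\<^bsup>-m\<^esup>\<close> is moved to the right through \<open>P\<^sub>j\<^sub>'\<^bsup>m'\<^esup>\<close>. As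
  \<open>[a\<^sup>2, \<cdot>]\<close> acts as \<open>- 2 J\<^sub>+\<close>, this yields \<open>\<Sum>\<^sub>n\<^sub>' \<langle>n'|(1 - 2 h J\<^sub>+)\<^bsup>-m\<^esup>|m'\<rangle> P\<^sub>j\<^sub>'\<^bsup>n'\<^esup> e\<^bsup>(m+n'-m') \<sigma>\<^esup>\<close>, and
  the matrix elements are those of the inverse twist.\<close>

section \<open>Racah's sum\<close>

text \<open>The alternating sign and the index \<open>v\<close> of Racah's sum come from
  contractions. In a product of Weyl monomials, a contraction pairs an \<open>abar\<close> of the
  left factor with an \<open>a\<close> of the right one, with weight 1/2, or an \<open>a\<close> of
  the left with an \<open>abar\<close> of the right, with weight -1/2. In the term of order
  \<open>r\<close> there are \<open>v\<close> contractions of the second kind and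
  \<open>r - v\<close> of the first, which accounts for \<open>(-1) ^ v\<close> and the four shifted
  factorials. The right factor supplies the first pair of arguments, hence the interchanged spins
  j', j in the Clebsch-Gordan coefficient. That coefficient rests on a definite description of the
  highest weight vector, so an explicit formula is reached through uniqueness of this vector,
  including norm and phase. None of this involves \<open>h\<close>, which enters only when e^(m
  sigma) passes the second symplecton.\<close>

definition inv_rfact :: "real \<Rightarrow> real" where
  "inv_rfact x = (if x \<in> \<nat> then 1 / rfact x else 0)"

lemma rfact_of_nat [simp]: "rfact (real n) = fact n"
  by (simp add: rfact_def)

lemma rfact_pos: "rfact x > 0"
  by (simp add: rfact_def)

lemma inv_rfact_of_nat: "inv_rfact (real n) = 1 / fact n"
  by (simp add: inv_rfact_def)

lemma inv_rfact_neg: "x < 0 \<Longrightarrow> inv_rfact x = 0"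
  by (auto simp: inv_rfact_def elim!: Nats_cases)

lemma inv_rfact_0 [simp]: "inv_rfact 0 = 1"
  using inv_rfact_of_nat[of 0] by simp

text \<open>Setting 1/x! to zero off the naturals keeps the recurrence valid at zero and at negative
  integers, so later index shifts need no boundary cases.\<close>

lemma inv_rfact_rec: "x \<in> \<int> \<Longrightarrow> x * inv_rfact x = inv_rfact (x - 1)"
proof -
  assume "x \<in> \<int>"
  then obtain i where i: "x = of_int i" by (auto elim: Ints_cases)
  show ?thesis
  proof (cases "i \<le> 0")
    case True
    then show ?thesis using i by (cases "i = 0") (auto simp: inv_rfact_neg)
  next
    case False
    then obtain n where n: "i = int (Suc n)"
      by (metis not_le zero_less_imp_eq_int gr0_implies_Suc)
    then have "x = real (Suc n)" "x - 1 = real n" using i by auto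
    then show ?thesis by (simp only: inv_rfact_of_nat fact_Suc) (simp add: field_simps del: of_nat_Suc)
  qed
qed

text \<open>Up to square roots of factorials this is Racah's sum for the Clebsch-Gordan coefficient
  \<open>\<langle>j1 m1; j2 m2|k m\<rangle>\<close> with \<open>r = j1 + j2 - k\<close>, \<open>q\<^sub>i = j\<^sub>i + m\<^sub>i\<close>, \<open>p\<^sub>i = j\<^sub>i - m\<^sub>i\<close>.\<close>

definition racah_sum :: "nat \<Rightarrow> real \<Rightarrow> real \<Rightarrow> real \<Rightarrow> real \<Rightarrow> real" where
  "racah_sum r q1 p1 q2 p2 = (\<Sum>v\<le>r. (-1) ^ v * inv_rfact (real (r - v)) * inv_rfact (real v)
     * inv_rfact (q1 - real (r - v)) * inv_rfact (p1 - real v)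
     * inv_rfact (q2 - real v) * inv_rfact (p2 - real (r - v)))"

text \<open>Reversing the summation, v to r - v, corresponds to reflecting both weights. It yields
  the relation in \<open>p2\<close> from that in \<open>q2\<close>, and raising from
  lowering.\<close>

lemma racah_sum_swap: "racah_sum r p1 q1 p2 q2 = (-1) ^ r * racah_sum r q1 p1 q2 p2"
proof -
  have "racah_sum r p1 q1 p2 q2 = (\<Sum>v\<le>r. (-1) ^ (r - v) * inv_rfact (real v) * inv_rfact (real (r - v))
     * inv_rfact (p1 - real v) * inv_rfact (q1 - real (r - v))
     * inv_rfact (p2 - real (r - v)) * inv_rfact (q2 - real v))"
    unfolding racah_sum_def
    by (rule sum.reindex_bij_witness[of _ "\<lambda>v. r - v" "\<lambda>v. r - v"]) auto
  also have "\<dots> = (-1) ^ r * racah_sum r q1 p1 q2 p2"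
    unfolding racah_sum_def sum_distrib_left
  proof (rule sum.cong[OF refl])
    fix v assume "v \<in> {..r}"
    then have "(-1::real) ^ (r - v) = (-1) ^ r * (-1) ^ v"
      by (simp add: uminus_power_if)
    then show "(-1) ^ (r - v) * inv_rfact (real v) * inv_rfact (real (r - v))
     * inv_rfact (p1 - real v) * inv_rfact (q1 - real (r - v))
     * inv_rfact (p2 - real (r - v)) * inv_rfact (q2 - real v) = (-1) ^ r * ((-1) ^ v * inv_rfact (real (r - v)) * inv_rfact (real v)
     * inv_rfact (q1 - real (r - v)) * inv_rfact (p1 - real v)
     * inv_rfact (q2 - real v) * inv_rfact (p2 - real (r - v)))" by simp
  qed
  finally show ?thesis .
qed

lemma racah_sum_0: "racah_sum 0 q1 p1 q2 p2 = inv_rfact q1 * inv_rfact p1 * inv_rfact q2 * inv_rfact p2"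
  by (simp add: racah_sum_def)

text \<open>In each case two of the shifted arguments have a negative sum that is independent of
  \<open>v\<close>, so one of them is negative. The first two conditions violate the triangle rule,
  the last two the bound on the weight.\<close>

lemma racah_sum_eq_0:
  assumes "q1 + p1 < real r \<or> q2 + p2 < real r \<or> q1 + q2 < real r \<or> p1 + p2 < real r"
  shows "racah_sum r q1 p1 q2 p2 = 0"
  unfolding racah_sum_def
proof (rule sum.neutral, rule ballI)
  fix v assume "v \<in> {..r}"
  then have "q1 - real (r - v) < 0 \<or> p1 - real v < 0 \<or> q2 - real v < 0 \<or> p2 - real (r - v) < 0"
    using assms by (auto simp: of_nat_diff)
  then show "(-1) ^ v * inv_rfact (real (r - v)) * inv_rfact (real v)
     * inv_rfact (q1 - real (r - v)) * inv_rfact (p1 - real v)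
     * inv_rfact (q2 - real v) * inv_rfact (p2 - real (r - v)) = 0"
    by (auto simp: inv_rfact_neg)
qed

lemma sum_atMost_Suc_shift_0: "f 0 = 0 \<Longrightarrow> (\<Sum>v\<le>Suc r. f v) = (\<Sum>v\<le>r. f (Suc v :: nat) :: real)"
  by (simp add: sum.atMost_Suc_shift del: sum.atMost_Suc)

text \<open>This lemma and the next two rewrite one summand: the prefactor \<open>x\<close> is split
  along a recurrence for \<open>y\<close>, and the remainder \<open>w\<close> is moved to the factor
  1/v! or 1/(r - v)! that it will cancel.\<close>

lemma mult_eq_split1:
  fixes x :: real
  assumes "x * y = z + w * y"
  shows "x * (c0 * c1 * c2 * c3 * c4 * y * c5) = c0 * c1 * c2 * c3 * c4 * z * c5 + c0 * c1 * (w * c2) * c3 * c4 * y * c5"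
proof -
  have "x * (c0 * c1 * c2 * c3 * c4 * y * c5) = c0 * c1 * c2 * c3 * c4 * (x * y) * c5" by simp
  then show ?thesis unfolding assms by (simp add: algebra_simps)
qed

lemma mult_eq_split2:
  fixes x :: real
  assumes "x * y = z + w * y" "y' = w' * z'"
  shows "x * (c0 * c1 * c2 * y * y' * c4 * c5) = w' * (c0 * c1 * c2 * z * z' * c4 * c5) + c0 * (w * c1) * c2 * y * y' * c4 * c5"
proof -
  have "x * (c0 * c1 * c2 * y * y' * c4 * c5) = c0 * c1 * c2 * (x * y) * y' * c4 * c5" by simp
  then show ?thesis unfolding assms(1) by (simp add: algebra_simps assms(2))
qed

lemma mult_eq_split3:
  fixes x :: real
  assumes "x * y = z + w * y" "y' = w' * z'"
  shows "x * (c0 * c1 * c2 * c3 * c4 * y * y') = w' * (c0 * c1 * c2 * c3 * c4 * z * z') + c0 * c1 * (w * c2) * c3 * c4 * y * y'"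
proof -
  have "x * (c0 * c1 * c2 * c3 * c4 * y * y') = c0 * c1 * c2 * c3 * c4 * (x * y) * y'" by simp
  then show ?thesis unfolding assms(1) by (simp add: algebra_simps assms(2))
qed

text \<open>This contiguous relation mirrors left multiplication by \<open>a\<close> in
  \<open>a_mult_weyl\<close>. Write \<open>q2 + 1\<close> as \<open>(q2 + 1 - v) + v\<close>: the
  first part lowers a factorial, the second cancels 1/v! and, after a shift of \<open>v\<close>,
  drops the order to \<open>r\<close>.\<close>

lemma racah_sum_Suc_q2:
  assumes ints: "q2 \<in> \<int>" "p1 \<in> \<int>" "p2 \<in> \<int>"
  shows "(q2 + 1) * racah_sum (Suc r) q1 p1 (q2 + 1) p2 =
    racah_sum (Suc r) q1 p1 q2 p2 - (p1 + p2 - real r) * racah_sum r q1 p1 q2 p2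
    + racah_sum r q1 p1 q2 (p2 - 1)"
proof -
  let ?d = inv_rfact
  have "(q2 + 1) * racah_sum (Suc r) q1 p1 (q2 + 1) p2 =
    (\<Sum>v\<le>Suc r. (-1) ^ v * ?d (real (Suc r - v)) * ?d (real v) * ?d (q1 - real (Suc r - v))
        * ?d (p1 - real v) * ?d (q2 - real v) * ?d (p2 - real (Suc r - v))
      + (-1) ^ v * ?d (real (Suc r - v)) * (real v * ?d (real v)) * ?d (q1 - real (Suc r - v))
        * ?d (p1 - real v) * ?d (q2 + 1 - real v) * ?d (p2 - real (Suc r - v)))"
    unfolding racah_sum_def sum_distrib_left
  proof (rule sum.cong[OF refl])
    fix v
    have "(q2 + 1) * ?d (q2 + 1 - real v) = ?d (q2 - real v) + real v * ?d (q2 + 1 - real v)"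
      using inv_rfact_rec[of "q2 + 1 - real v"] ints by (simp add: algebra_simps)
    then show "(q2 + 1) * ((-1) ^ v * ?d (real (Suc r - v)) * ?d (real v) * ?d (q1 - real (Suc r - v))
        * ?d (p1 - real v) * ?d (q2 + 1 - real v) * ?d (p2 - real (Suc r - v)))
      = (-1) ^ v * ?d (real (Suc r - v)) * ?d (real v) * ?d (q1 - real (Suc r - v))
        * ?d (p1 - real v) * ?d (q2 - real v) * ?d (p2 - real (Suc r - v))
      + (-1) ^ v * ?d (real (Suc r - v)) * (real v * ?d (real v)) * ?d (q1 - real (Suc r - v))
        * ?d (p1 - real v) * ?d (q2 + 1 - real v) * ?d (p2 - real (Suc r - v))"
      by (rule mult_eq_split1)
  qed
  also have "\<dots> = racah_sum (Suc r) q1 p1 q2 p2 +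
    (\<Sum>v\<le>Suc r. (-1) ^ v * ?d (real (Suc r - v)) * (real v * ?d (real v)) * ?d (q1 - real (Suc r - v))
        * ?d (p1 - real v) * ?d (q2 + 1 - real v) * ?d (p2 - real (Suc r - v)))"
    unfolding racah_sum_def sum.distrib ..
  also have "(\<Sum>v\<le>Suc r. (-1) ^ v * ?d (real (Suc r - v)) * (real v * ?d (real v)) * ?d (q1 - real (Suc r - v))
        * ?d (p1 - real v) * ?d (q2 + 1 - real v) * ?d (p2 - real (Suc r - v)))
    = (\<Sum>v\<le>r. (-1) ^ Suc v * ?d (real (r - v)) * (real (Suc v) * ?d (real (Suc v))) * ?d (q1 - real (r - v))
        * ?d (p1 - real (Suc v)) * ?d (q2 + 1 - real (Suc v)) * ?d (p2 - real (r - v)))"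
    by (subst sum_atMost_Suc_shift_0) (simp_all del: of_nat_Suc)
  \<comment> \<open>The new factor is \<open>p1 - v = (p1 + p2 - r) - (p2 - (r - v))\<close>, whose
    second part lowers the factorial of \<open>p2\<close>.\<close>
  also have "\<dots> = (\<Sum>v\<le>r. - (p1 + p2 - real r) * ((-1) ^ v * ?d (real (r - v)) * ?d (real v) * ?d (q1 - real (r - v))
        * ?d (p1 - real v) * ?d (q2 - real v) * ?d (p2 - real (r - v)))
      + (-1) ^ v * ?d (real (r - v)) * ?d (real v) * ?d (q1 - real (r - v))
        * ?d (p1 - real v) * ?d (q2 - real v) * ?d (p2 - 1 - real (r - v)))"
  proof (rule sum.cong[OF refl])
    fix v assume "v \<in> {..r}"
    then have r: "real (r - v) = real r - real v" by (simp add: of_nat_diff)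
    have 1: "real (Suc v) * ?d (real (Suc v)) = ?d (real v)"
      using inv_rfact_rec[of "real (Suc v)"] by (simp)
    have 2: "?d (p1 - real (Suc v)) = (p1 - real v) * ?d (p1 - real v)"
      using inv_rfact_rec[of "p1 - real v"] ints by (simp add: algebra_simps)
    have 3: "?d (p2 - 1 - real (r - v)) = (p2 - real (r - v)) * ?d (p2 - real (r - v))"
      using inv_rfact_rec[of "p2 - real (r - v)"] ints by (simp add: algebra_simps)
    have 4: "q2 + 1 - real (Suc v) = q2 - real v" by simp
    show "(-1) ^ Suc v * ?d (real (r - v)) * (real (Suc v) * ?d (real (Suc v))) * ?d (q1 - real (r - v))
        * ?d (p1 - real (Suc v)) * ?d (q2 + 1 - real (Suc v)) * ?d (p2 - real (r - v))
      = - (p1 + p2 - real r) * ((-1) ^ v * ?d (real (r - v)) * ?d (real v) * ?d (q1 - real (r - v))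
        * ?d (p1 - real v) * ?d (q2 - real v) * ?d (p2 - real (r - v)))
      + (-1) ^ v * ?d (real (r - v)) * ?d (real v) * ?d (q1 - real (r - v))
        * ?d (p1 - real v) * ?d (q2 - real v) * ?d (p2 - 1 - real (r - v))"
      unfolding 1 2 3 4 power_Suc unfolding r by (simp add: algebra_simps)
  qed
  also have "\<dots> = - (p1 + p2 - real r) * racah_sum r q1 p1 q2 p2 + racah_sum r q1 p1 q2 (p2 - 1)"
    unfolding racah_sum_def sum.distrib sum_distrib_left ..
  finally show ?thesis by (simp add: algebra_simps)
qed

lemma racah_sum_Suc_p2:
  assumes "p2 \<in> \<int>" "q1 \<in> \<int>" "q2 \<in> \<int>"
  shows "(p2 + 1) * racah_sum (Suc r) q1 p1 q2 (p2 + 1) =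
    racah_sum (Suc r) q1 p1 q2 p2 + (q1 + q2 - real r) * racah_sum r q1 p1 q2 p2
    - racah_sum r q1 p1 (q2 - 1) p2"
proof -
  have "(p2 + 1) * ((-1) ^ Suc r * racah_sum (Suc r) q1 p1 q2 (p2 + 1)) =
    (-1) ^ Suc r * racah_sum (Suc r) q1 p1 q2 p2
      - (q1 + q2 - real r) * ((-1) ^ r * racah_sum r q1 p1 q2 p2)
    + (-1) ^ r * racah_sum r q1 p1 (q2 - 1) p2"
    using racah_sum_Suc_q2[OF assms, of r p1] unfolding racah_sum_swap[of _ p1 q1] .
  then have "(-1) ^ r * ((p2 + 1) * racah_sum (Suc r) q1 p1 q2 (p2 + 1)) =
    (-1) ^ r * (racah_sum (Suc r) q1 p1 q2 p2 + (q1 + q2 - real r) * racah_sum r q1 p1 q2 p2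
    - racah_sum r q1 p1 (q2 - 1) p2)"
    by (simp add: algebra_simps)
  then show ?thesis by (simp only: mult_cancel_left) simp
qed

text \<open>This is the action of \<open>J_minus\<close> on unnormalized components. Splitting
  \<open>q1 + 1\<close> and \<open>q2 + 1\<close> leaves the factor
  \<open>(p1 - v) + (p2 - (r - v))\<close>, which is constant in \<open>v\<close>, and two
  remainders that cancel after a shift of \<open>v\<close>.\<close>

lemma racah_sum_lower:
  assumes ints: "q1 \<in> \<int>" "p1 \<in> \<int>" "q2 \<in> \<int>" "p2 \<in> \<int>"
  shows "(q1 + 1) * racah_sum r (q1 + 1) (p1 - 1) q2 p2
    + (q2 + 1) * racah_sum r q1 p1 (q2 + 1) (p2 - 1)
    = (p1 + p2 - real r) * racah_sum r q1 p1 q2 p2"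
proof -
  let ?d = inv_rfact
  let ?t = "\<lambda>v. (-1) ^ v * ?d (real (r - v)) * ?d (real v) * ?d (q1 - real (r - v))
        * ?d (p1 - real v) * ?d (q2 - real v) * ?d (p2 - real (r - v))"
  let ?A = "\<lambda>v. (-1) ^ v * (real (r - v) * ?d (real (r - v))) * ?d (real v) * ?d (q1 + 1 - real (r - v))
        * ?d (p1 - 1 - real v) * ?d (q2 - real v) * ?d (p2 - real (r - v))"
  let ?B = "\<lambda>v. (-1) ^ v * ?d (real (r - v)) * (real v * ?d (real v)) * ?d (q1 - real (r - v))
        * ?d (p1 - real v) * ?d (q2 + 1 - real v) * ?d (p2 - 1 - real (r - v))"
  have 1: "(q1 + 1) * racah_sum r (q1 + 1) (p1 - 1) q2 p2 = (\<Sum>v\<le>r. (p1 - real v) * ?t v + ?A v)"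
    unfolding racah_sum_def sum_distrib_left
  proof (rule sum.cong[OF refl])
    fix v
    have "(q1 + 1) * ?d (q1 + 1 - real (r - v)) = ?d (q1 - real (r - v)) + real (r - v) * ?d (q1 + 1 - real (r - v))"
      using inv_rfact_rec[of "q1 + 1 - real (r - v)"] ints by (simp add: algebra_simps)
    moreover have "?d (p1 - 1 - real v) = (p1 - real v) * ?d (p1 - real v)"
      using inv_rfact_rec[of "p1 - real v"] ints by (simp add: algebra_simps)
    ultimately show "(q1 + 1) * ((-1) ^ v * ?d (real (r - v)) * ?d (real v) * ?d (q1 + 1 - real (r - v))
        * ?d (p1 - 1 - real v) * ?d (q2 - real v) * ?d (p2 - real (r - v))) = (p1 - real v) * ?t v + ?A v"
      by (rule mult_eq_split2)
  qed
  have 2: "(q2 + 1) * racah_sum r q1 p1 (q2 + 1) (p2 - 1) = (\<Sum>v\<le>r. (p2 - real (r - v)) * ?t v + ?B v)"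
    unfolding racah_sum_def sum_distrib_left
  proof (rule sum.cong[OF refl])
    fix v
    have "(q2 + 1) * ?d (q2 + 1 - real v) = ?d (q2 - real v) + real v * ?d (q2 + 1 - real v)"
      using inv_rfact_rec[of "q2 + 1 - real v"] ints by (simp add: algebra_simps)
    moreover have "?d (p2 - 1 - real (r - v)) = (p2 - real (r - v)) * ?d (p2 - real (r - v))"
      using inv_rfact_rec[of "p2 - real (r - v)"] ints by (simp add: algebra_simps)
    ultimately show "(q2 + 1) * ((-1) ^ v * ?d (real (r - v)) * ?d (real v) * ?d (q1 - real (r - v))
        * ?d (p1 - real v) * ?d (q2 + 1 - real v) * ?d (p2 - 1 - real (r - v)))
        = (p2 - real (r - v)) * ?t v + ?B v"
      by (rule mult_eq_split3)
  qed
  have 3: "(\<Sum>v\<le>r. ?A v) + (\<Sum>v\<le>r. ?B v) = 0"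
  proof (cases r)
    case 0
    then show ?thesis by simp
  next
    case (Suc n)
    have "(\<Sum>v\<le>r. ?B v) = (\<Sum>v\<le>n. ?B (Suc v))"
      unfolding Suc by (subst sum_atMost_Suc_shift_0) (simp_all del: of_nat_Suc)
    also have "\<dots> = (\<Sum>v\<le>n. - ?A v)"
    proof (rule sum.cong[OF refl])
      fix v assume "v \<in> {..n}"
      then have r: "r - v = Suc (n - v)" "r - Suc v = n - v" using Suc by auto
      have d: "real (Suc i) * ?d (real (Suc i)) = ?d (real i)" for i
        using inv_rfact_rec[of "real (Suc i)"] by (simp)
      have e: "p1 - real (Suc v) = p1 - 1 - real v" "q2 + 1 - real (Suc v) = q2 - real v"
        "q1 + 1 - real (Suc (n - v)) = q1 - real (n - v)"
        "p2 - real (Suc (n - v)) = p2 - 1 - real (n - v)" by simp_all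
      show "?B (Suc v) = - ?A v" unfolding r d e by simp
    qed
    also have "\<dots> = - (\<Sum>v\<le>r. ?A v)" unfolding Suc by (simp add: sum_negf)
    finally show ?thesis by simp
  qed
  have "(\<Sum>v\<le>r. (p1 - real v) * ?t v + ?A v) + (\<Sum>v\<le>r. (p2 - real (r - v)) * ?t v + ?B v)
     = (\<Sum>v\<le>r. (p1 - real v) * ?t v + (p2 - real (r - v)) * ?t v)"
    using 3 by (simp add: sum.distrib)
  also have "\<dots> = (\<Sum>v\<le>r. (p1 + p2 - real r) * ?t v)"
    by (rule sum.cong[OF refl]) (simp add: of_nat_diff distrib_right[symmetric])
  also have "\<dots> = (p1 + p2 - real r) * racah_sum r q1 p1 q2 p2"
    unfolding racah_sum_def sum_distrib_left ..
  finally show ?thesis using 1 2 by simp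
qed

lemma racah_sum_raise:
  assumes "q1 \<in> \<int>" "p1 \<in> \<int>" "q2 \<in> \<int>" "p2 \<in> \<int>"
  shows "(p1 + 1) * racah_sum r (q1 - 1) (p1 + 1) q2 p2
    + (p2 + 1) * racah_sum r q1 p1 (q2 - 1) (p2 + 1)
    = (q1 + q2 - real r) * racah_sum r q1 p1 q2 p2"
proof -
  have "(-1) ^ r * ((p1 + 1) * racah_sum r (q1 - 1) (p1 + 1) q2 p2
    + (p2 + 1) * racah_sum r q1 p1 (q2 - 1) (p2 + 1))
    = (-1) ^ r * ((q1 + q2 - real r) * racah_sum r q1 p1 q2 p2)"
    using racah_sum_lower[OF assms(2,1,4,3), of r]
    unfolding racah_sum_swap[of _ p1 q1] racah_sum_swap[of _ "p1+1" "q1-1"]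
    by (simp add: algebra_simps)
  then show ?thesis by (simp only: mult_cancel_left) simp
qed

lemma racah_sum_neg: "q1 < 0 \<or> p1 < 0 \<or> q2 < 0 \<or> p2 < 0 \<Longrightarrow> racah_sum r q1 p1 q2 p2 = 0"
  unfolding racah_sum_def by (intro sum.neutral ballI) (auto simp: inv_rfact_neg)

text \<open>Pascal's rule in the form that drives both \<open>weyl_conv_sum\<close> and
  \<open>power_mult_commutator\<close>.\<close>

lemma sum_choose_Suc:
  fixes f :: "nat \<Rightarrow> nat \<Rightarrow> 'a::real_vector"
  shows "(\<Sum>s\<le>Suc p. real (Suc p choose s) *\<^sub>R f (Suc p - s) s) =
    (\<Sum>s\<le>p. real (p choose s) *\<^sub>R (f (Suc (p - s)) s + f (p - s) (Suc s)))"
proof -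
  have "(\<Sum>s\<le>p. real (p choose s) *\<^sub>R f (Suc (p - s)) s) =
      (\<Sum>s\<le>Suc p. real (p choose s) *\<^sub>R f (Suc p - s) s)"
    by (simp add: Suc_diff_le)
  also have "\<dots> = f (Suc p) 0 + (\<Sum>s\<le>p. real (p choose Suc s) *\<^sub>R f (p - s) (Suc s))"
    by (simp add: sum.atMost_Suc_shift del: sum.atMost_Suc)
  finally show ?thesis
    by (simp add: sum.atMost_Suc_shift sum.distrib scaleR_add_left scaleR_add_right del: sum.atMost_Suc)
qed

section \<open>Products of Weyl ordered monomials\<close>

text \<open>The Weyl (totally symmetric) ordering of \<open>a\<^sup>q b\<^sup>p\<close>.\<close>

primrec weyl :: "'w::real_algebra_1 \<Rightarrow> 'w \<Rightarrow> nat \<Rightarrow> nat \<Rightarrow> 'w" where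
  "weyl a b q 0 = a ^ q"
| "weyl a b q (Suc p) = (1 / 2) *\<^sub>R (b * weyl a b q p + weyl a b q p * b)"

lemma weyl_conv_sum:
  "weyl a b q p = (1 / 2 ^ p) *\<^sub>R (\<Sum>s\<le>p. real (p choose s) *\<^sub>R (b ^ (p - s) * a ^ q * b ^ s))"
proof (induction p)
  case (Suc p)
  have "weyl a b q (Suc p) = (1 / (2 * 2 ^ p)) *\<^sub>R (\<Sum>s\<le>p. real (p choose s) *\<^sub>R
      (b * b ^ (p - s) * a ^ q * b ^ s + b ^ (p - s) * a ^ q * b ^ Suc s))"
    by (simp add: Suc.IH sum_distrib_left sum_distrib_right power_Suc2[of b] mult.assoc
        sum.distrib scaleR_add_right power_commutes del: power_Suc)
  also have "\<dots> = (1 / 2 ^ Suc p) *\<^sub>R (\<Sum>s\<le>Suc p. real (Suc p choose s) *\<^sub>R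
      (b ^ (Suc p - s) * a ^ q * b ^ s))"
    by (subst sum_choose_Suc[where f = "\<lambda>i s. b ^ i * a ^ q * b ^ s"]) simp
  finally show ?case .
qed simp

text \<open>Only the total coefficient of each \<open>U r\<close> has to agree, not the summands.
  The contiguous relations of Racah sums give equality only after this regrouping.\<close>

lemma sum_scaleR_shift_cong:
  fixes U :: "nat \<Rightarrow> 'a::real_vector"
  assumes "\<alpha> 0 = \<alpha>' 0" "\<And>r. \<alpha> (Suc r) + \<beta> r = \<alpha>' (Suc r) + \<beta>' r" "\<beta> (Suc R) = 0" "\<beta>' (Suc R) = 0"
  shows "(\<Sum>r\<le>Suc R. \<alpha> r *\<^sub>R U r + \<beta> r *\<^sub>R U (Suc r)) = (\<Sum>r\<le>Suc R. \<alpha>' r *\<^sub>R U r + \<beta>' r *\<^sub>R U (Suc r))"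
proof -
  have shift: "(\<Sum>r\<le>Suc R. \<alpha> r *\<^sub>R U r + \<beta> r *\<^sub>R U (Suc r)) =
      \<alpha> 0 *\<^sub>R U 0 + (\<Sum>r\<le>R. (\<alpha> (Suc r) + \<beta> r) *\<^sub>R U (Suc r))"
    if "\<beta> (Suc R) = 0" for \<alpha> \<beta>
  proof -
    have "(\<Sum>r\<le>Suc R. \<alpha> r *\<^sub>R U r + \<beta> r *\<^sub>R U (Suc r)) =
      (\<Sum>r\<le>Suc R. \<alpha> r *\<^sub>R U r) + (\<Sum>r\<le>R. \<beta> r *\<^sub>R U (Suc r))"
      using that by (simp add: sum.distrib)
    then show ?thesis
      by (simp only: sum.atMost_Suc_shift sum.distrib scaleR_add_left add.assoc)
  qed
  show ?thesis using assms by (simp only: shift)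
qed

section \<open>Boson operators acting on Weyl monomials\<close>

context
  fixes a abar :: "'w::real_algebra_1"
  assumes boson: "abar * a - a * abar = 1"
begin

lemma abar_a: "abar * a = a * abar + 1"
  using boson by (simp add: algebra_simps)

lemma abar_power: "abar * a ^ q - a ^ q * abar = real q *\<^sub>R a ^ (q - 1)"
proof (induction q)
  case (Suc q)
  have "abar * a ^ Suc q - a ^ Suc q * abar = (abar * a) * a ^ q - a * (a ^ q * abar)"
    by (simp add: mult.assoc)
  also have "\<dots> = a * (abar * a ^ q - a ^ q * abar) + a ^ q"
    unfolding abar_a by (simp add: algebra_simps)
  also have "\<dots> = real (Suc q) *\<^sub>R a ^ q"
    unfolding Suc.IH by (cases q) (auto simp: algebra_simps scaleR_2)
  finally show ?case by simp
qed simp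

text \<open>Commutation with \<open>abar\<close> is a derivation that kills \<open>abar\<close>, so
  it passes through the symmetrization and acts only on \<open>a ^ q\<close>.\<close>

lemma abar_commutator_weyl:
  "abar * weyl a abar q p - weyl a abar q p * abar = real q *\<^sub>R weyl a abar (q - 1) p"
proof (induction p)
  case 0
  then show ?case by (simp add: abar_power)
next
  case (Suc p)
  let ?S = "weyl a abar q p"
  have "abar * weyl a abar q (Suc p) - weyl a abar q (Suc p) * abar
    = (1 / 2) *\<^sub>R (abar * (abar * ?S - ?S * abar) + (abar * ?S - ?S * abar) * abar)"
    by (simp add: algebra_simps)
  then show ?case unfolding Suc.IH by (simp add: algebra_simps)
qed

text \<open>A left product is half the anticommutator plus half the commutator.\<close>

lemma abar_mult_weyl:
  "abar * weyl a abar q p = weyl a abar q (Suc p) + (real q / 2) *\<^sub>R weyl a abar (q - 1) p"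
proof -
  have "weyl a abar q (Suc p) + (1 / 2) *\<^sub>R (real q *\<^sub>R weyl a abar (q - 1) p)
     = (1 / 2 + 1 / 2) *\<^sub>R (abar * weyl a abar q p)"
    unfolding abar_commutator_weyl[symmetric] scaleR_add_left by (simp add: algebra_simps)
  then show ?thesis by simp
qed

text \<open>The induction is on \<open>p\<close>, since \<open>weyl\<close> is built up by
  \<open>abar\<close> only; moving \<open>a\<close> through each symmetrization step costs half of a
  lower monomial.\<close>

lemma a_mult_weyl:
  "a * weyl a abar q p = weyl a abar (Suc q) p - (real p / 2) *\<^sub>R weyl a abar q (p - 1)"
proof (induction p)
  case (Suc p)
  let ?S = "weyl a abar q p"
  have "a * weyl a abar q (Suc p) = (1 / 2) *\<^sub>R ((a * abar) * ?S + (a * ?S) * abar)"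
    by (simp add: algebra_simps)
  also have "a * abar = abar * a - 1" using abar_a by simp
  also have "(1 / 2) *\<^sub>R ((abar * a - 1) * ?S + (a * ?S) * abar)
    = (1 / 2) *\<^sub>R (abar * (a * ?S) + (a * ?S) * abar) - (1 / 2) *\<^sub>R ?S"
    by (simp add: algebra_simps)
  also have "\<dots> = weyl a abar (Suc q) (Suc p) - (real p / 2) *\<^sub>R
     ((1 / 2) *\<^sub>R (abar * weyl a abar q (p - 1) + weyl a abar q (p - 1) * abar)) - (1 / 2) *\<^sub>R ?S"
    unfolding Suc.IH by (simp add: algebra_simps)
  also have "(real p / 2) *\<^sub>R
     ((1 / 2) *\<^sub>R (abar * weyl a abar q (p - 1) + weyl a abar q (p - 1) * abar)) = (real p / 2) *\<^sub>R ?S"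
    by (cases p) auto
  finally show ?case by (simp add: algebra_simps add_divide_distrib)
qed simp

lemma weyl_mult_a:
  "weyl a abar q p * a = weyl a abar (Suc q) p + (real p / 2) *\<^sub>R weyl a abar q (p - 1)"
proof (induction p)
  case 0
  then show ?case by (simp add: power_commutes)
next
  case (Suc p)
  let ?S = "weyl a abar q p"
  have "weyl a abar q (Suc p) * a = (1 / 2) *\<^sub>R (abar * (?S * a) + ?S * (abar * a))"
    by (simp add: algebra_simps)
  also have "abar * a = a * abar + 1" by (rule abar_a)
  also have "(1 / 2) *\<^sub>R (abar * (?S * a) + ?S * (a * abar + 1))
    = (1 / 2) *\<^sub>R (abar * (?S * a) + (?S * a) * abar) + (1 / 2) *\<^sub>R ?S"
    by (simp add: algebra_simps)
  also have "\<dots> = weyl a abar (Suc q) (Suc p) + (real p / 2) *\<^sub>R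
     ((1 / 2) *\<^sub>R (abar * weyl a abar q (p - 1) + weyl a abar q (p - 1) * abar)) + (1 / 2) *\<^sub>R ?S"
    unfolding Suc.IH by (simp add: algebra_simps)
  also have "(real p / 2) *\<^sub>R
     ((1 / 2) *\<^sub>R (abar * weyl a abar q (p - 1) + weyl a abar q (p - 1) * abar)) = (real p / 2) *\<^sub>R ?S"
    by (cases p) auto
  finally show ?case by (simp add: algebra_simps add_divide_distrib)
qed

text \<open>Based on [a^2, x] = [a, a x + x a], where both operations on the right send a Weyl
  monomial to a multiple of a single one.\<close>

lemma a_sq_commutator_weyl:
  "a ^ 2 * weyl a abar q p - weyl a abar q p * a ^ 2 = (- 2 * real p) *\<^sub>R weyl a abar (Suc q) (p - 1)"
proof -
  let ?D = "\<lambda>x. a * x - x * a"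
  have 1: "?D (weyl a abar q p) = - real p *\<^sub>R weyl a abar q (p - 1)" for q
  proof -
    have "?D (weyl a abar q p) = - ((real p / 2 + real p / 2) *\<^sub>R weyl a abar q (p - 1))"
      unfolding a_mult_weyl weyl_mult_a scaleR_add_left by (simp add: algebra_simps)
    then show ?thesis by simp
  qed
  have "a * weyl a abar q p + weyl a abar q p * a = 2 *\<^sub>R weyl a abar (Suc q) p"
    unfolding a_mult_weyl weyl_mult_a by (simp add: scaleR_2)
  then have "?D (a * weyl a abar q p + weyl a abar q p * a) = 2 *\<^sub>R ?D (weyl a abar (Suc q) p)"
    by (simp add: algebra_simps)
  then show ?thesis unfolding 1 by (simp add: algebra_simps power2_eq_square)
qed

text \<open>The Moyal product of two monomials, whose \<open>r\<close>-th transvectant is a Racah sum.\<close>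

lemma weyl_mult:
  assumes R: "q1 + p1 \<le> R"
  shows "weyl a abar q2 p2 * weyl a abar q1 p1 = (\<Sum>r\<le>R.
    (fact q1 * fact p1 * fact q2 * fact p2 / 2 ^ r * racah_sum r (real q1) (real p1) (real q2) (real p2))
      *\<^sub>R weyl a abar (q1 + q2 - r) (p1 + p2 - r))"
proof -
  let ?E = "\<lambda>r x y. racah_sum r (real q1) (real p1) x y"
  \<comment> \<open>The range ends at \<open>Suc R\<close> to leave room for the shift of
    \<open>r\<close>; the top term vanishes because \<open>q1 + p1 < Suc R\<close>.\<close>
  define M where "M q p = (\<Sum>r\<le>Suc R. (?E r (real q) (real p) / 2 ^ r) *\<^sub>R weyl a abar (q1 + q - r) (p1 + p - r))"
    for q p
  have E_large: "?E (Suc R) x y = 0" for x y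
    using R by (intro racah_sum_eq_0) auto
  have rec_a: "a * M q p = (real q + 1) *\<^sub>R M (Suc q) p - (1 / 2) *\<^sub>R
      (\<Sum>r\<le>Suc R. (?E r (real q) (real p - 1) / 2 ^ r) *\<^sub>R weyl a abar (q1 + q - r) (p1 + p - Suc r))" for q p
  proof -
    let ?U = "\<lambda>r. weyl a abar (q1 + Suc q - r) (p1 + p - r)"
    have "a * M q p = (\<Sum>r\<le>Suc R. (?E r (real q) (real p) / 2 ^ r) *\<^sub>R ?U r
        - (?E r (real q) (real p) * (real p1 + real p - real r) / 2 ^ Suc r) *\<^sub>R ?U (Suc r))"
      unfolding M_def sum_distrib_left
    proof (rule sum.cong[OF refl])
      fix r
      show "a * ((?E r (real q) (real p) / 2 ^ r) *\<^sub>R weyl a abar (q1 + q - r) (p1 + p - r))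
        = (?E r (real q) (real p) / 2 ^ r) *\<^sub>R ?U r
        - (?E r (real q) (real p) * (real p1 + real p - real r) / 2 ^ Suc r) *\<^sub>R ?U (Suc r)"
      \<comment> \<open>Outside this range natural subtraction truncates an exponent, but there the
        Racah sum is zero.\<close>
      proof (cases "r \<le> q1 + q \<and> r \<le> p1 + p")
        case True
        then have "q1 + Suc q - r = Suc (q1 + q - r)" by arith
        moreover have "real (p1 + p - r) = real p1 + real p - real r" using True by simp
        ultimately show ?thesis
          by (simp add: a_mult_weyl scaleR_diff_right)
      next
        case False
        then have "?E r (real q) (real p) = 0" by (intro racah_sum_eq_0) auto
        then show ?thesis by simp
      qed
    qed
    also have "\<dots> = (\<Sum>r\<le>Suc R. (?E r (real q) (real p) / 2 ^ r) *\<^sub>R ?U r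
        + (- ?E r (real q) (real p) * (real p1 + real p - real r) / 2 ^ Suc r) *\<^sub>R ?U (Suc r))"
      by simp
    also have "\<dots> = (\<Sum>r\<le>Suc R. ((real q + 1) * ?E r (real q + 1) (real p) / 2 ^ r) *\<^sub>R ?U r
        + (- ?E r (real q) (real p - 1) / 2 ^ Suc r) *\<^sub>R ?U (Suc r))"
    proof (rule sum_scaleR_shift_cong)
      show "?E 0 (real q) (real p) / 2 ^ 0 = (real q + 1) * ?E 0 (real q + 1) (real p) / 2 ^ 0"
        using inv_rfact_rec[of "real q + 1"] by (simp add: racah_sum_0)
      show "?E (Suc r) (real q) (real p) / 2 ^ Suc r + - ?E r (real q) (real p) * (real p1 + real p - real r) / 2 ^ Suc r
        = (real q + 1) * ?E (Suc r) (real q + 1) (real p) / 2 ^ Suc r + - ?E r (real q) (real p - 1) / 2 ^ Suc r" for r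
        by (subst racah_sum_Suc_q2) (simp_all add: field_simps)
    qed (simp_all add: E_large)
    also have "\<dots> = (real q + 1) *\<^sub>R M (Suc q) p - (1 / 2) *\<^sub>R
      (\<Sum>r\<le>Suc R. (?E r (real q) (real p - 1) / 2 ^ r) *\<^sub>R weyl a abar (q1 + q - r) (p1 + p - Suc r))"
      by (simp add: M_def scaleR_sum_right sum_subtractf E_large add.commute)
    finally show ?thesis .
  qed
  have rec_abar: "abar * M q p = (real p + 1) *\<^sub>R M q (Suc p) + (1 / 2) *\<^sub>R
      (\<Sum>r\<le>Suc R. (?E r (real q - 1) (real p) / 2 ^ r) *\<^sub>R weyl a abar (q1 + q - Suc r) (p1 + p - r))" for q p
  proof -
    let ?U = "\<lambda>r. weyl a abar (q1 + q - r) (p1 + Suc p - r)"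
    have "abar * M q p = (\<Sum>r\<le>Suc R. (?E r (real q) (real p) / 2 ^ r) *\<^sub>R ?U r
        + (?E r (real q) (real p) * (real q1 + real q - real r) / 2 ^ Suc r) *\<^sub>R ?U (Suc r))"
      unfolding M_def sum_distrib_left
    proof (rule sum.cong[OF refl])
      fix r
      show "abar * ((?E r (real q) (real p) / 2 ^ r) *\<^sub>R weyl a abar (q1 + q - r) (p1 + p - r))
        = (?E r (real q) (real p) / 2 ^ r) *\<^sub>R ?U r
        + (?E r (real q) (real p) * (real q1 + real q - real r) / 2 ^ Suc r) *\<^sub>R ?U (Suc r)"
      proof (cases "r \<le> q1 + q \<and> r \<le> p1 + p")
        case True
        then have "p1 + Suc p - r = Suc (p1 + p - r)" by arith
        moreover have "real (q1 + q - r) = real q1 + real q - real r" using True by simp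
        ultimately show ?thesis
          by (simp add: abar_mult_weyl scaleR_add_right del: weyl.simps)
      next
        case False
        then have "?E r (real q) (real p) = 0" by (intro racah_sum_eq_0) auto
        then show ?thesis by simp
      qed
    qed
    also have "\<dots> = (\<Sum>r\<le>Suc R. ((real p + 1) * ?E r (real q) (real p + 1) / 2 ^ r) *\<^sub>R ?U r
        + (?E r (real q - 1) (real p) / 2 ^ Suc r) *\<^sub>R ?U (Suc r))"
    proof (rule sum_scaleR_shift_cong)
      show "?E 0 (real q) (real p) / 2 ^ 0 = (real p + 1) * ?E 0 (real q) (real p + 1) / 2 ^ 0"
        using inv_rfact_rec[of "real p + 1"] by (simp add: racah_sum_0)
      show "?E (Suc r) (real q) (real p) / 2 ^ Suc r + ?E r (real q) (real p) * (real q1 + real q - real r) / 2 ^ Suc r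
        = (real p + 1) * ?E (Suc r) (real q) (real p + 1) / 2 ^ Suc r + ?E r (real q - 1) (real p) / 2 ^ Suc r" for r
        by (subst racah_sum_Suc_p2) (simp_all add: field_simps)
    qed (simp_all add: E_large)
    also have "\<dots> = (real p + 1) *\<^sub>R M q (Suc p) + (1 / 2) *\<^sub>R
      (\<Sum>r\<le>Suc R. (?E r (real q - 1) (real p) / 2 ^ r) *\<^sub>R weyl a abar (q1 + q - Suc r) (p1 + p - r))"
      by (simp add: M_def scaleR_sum_right sum.distrib E_large add.commute del: weyl.simps)
    finally show ?thesis .
  qed
  define c :: real where "c = fact q1 * fact p1"
  let ?W = "weyl a abar q1 p1"
  have "weyl a abar q p * ?W = (c * fact q * fact p) *\<^sub>R M q p" for q p
  \<comment> \<open>For \<open>q = 0\<close> the relation \<open>rec_abar\<close> suffices, as its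
    remainder has the negative argument \<open>q - 1\<close>; all larger \<open>q\<close> come from
    \<open>rec_a\<close>.\<close>
  proof (induction q arbitrary: p)
    case 0
    show ?case
    proof (induction p)
      case 0
      have "M 0 0 = (\<Sum>r\<le>Suc R. if r = 0 then (1 / c) *\<^sub>R ?W else 0)"
        unfolding M_def by (rule sum.cong) (auto simp: racah_sum_eq_0 racah_sum_0 inv_rfact_of_nat c_def)
      also have "\<dots> = (1 / c) *\<^sub>R ?W" by (simp add: sum.delta del: sum.atMost_Suc)
      finally show ?case by (simp add: c_def)
    next
      case (Suc p)
      have "weyl a abar 0 (Suc p) * ?W = abar * (weyl a abar 0 p * ?W)"
        using abar_mult_weyl[of 0 p] by (simp add: mult.assoc[symmetric] del: weyl.simps)
      also have "\<dots> = (c * fact 0 * fact p) *\<^sub>R (abar * M 0 p)" by (simp add: Suc.IH)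
      also have "\<dots> = (c * fact 0 * fact (Suc p)) *\<^sub>R M 0 (Suc p)"
        by (simp add: rec_abar racah_sum_neg algebra_simps del: weyl.simps sum.atMost_Suc)
      finally show ?case .
    qed
  next
    case (Suc q)
    \<comment> \<open>This is \<open>a_mult_weyl\<close> solved for the higher monomial; its lower
      term cancels the remainder sum of \<open>rec_a\<close>.\<close>
    have "weyl a abar (Suc q) p * ?W = a * (weyl a abar q p * ?W) + (real p / 2) *\<^sub>R (weyl a abar q (p - 1) * ?W)"
      unfolding mult.assoc[symmetric] a_mult_weyl by (simp add: algebra_simps)
    also have "\<dots> = (c * fact q) *\<^sub>R (fact p *\<^sub>R (a * M q p) + (real p / 2 * fact (p - 1)) *\<^sub>R M q (p - 1))"
      by (simp add: Suc.IH scaleR_add_right mult_ac)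
    also have "\<dots> = (c * fact q) *\<^sub>R (fact p *\<^sub>R ((real q + 1) *\<^sub>R M (Suc q) p))"
    proof (cases p)
      case 0
      then show ?thesis by (simp add: rec_a racah_sum_neg del: sum.atMost_Suc)
    next
      case (Suc p')
      then show ?thesis by (simp add: rec_a M_def[of q p'] algebra_simps add_divide_distrib del: sum.atMost_Suc)
    qed
    finally show ?case by (simp add: algebra_simps)
  qed
  note this[of q2 p2]
  also have "M q2 p2 = (\<Sum>r\<le>R. (?E r (real q2) (real p2) / 2 ^ r) *\<^sub>R weyl a abar (q1 + q2 - r) (p1 + p2 - r))"
    by (simp add: M_def E_large)
  finally show ?thesis by (simp add: scaleR_sum_right c_def mult_ac)
qed

end

section \<open>Clebsch-Gordan coefficients\<close>

lemma finite_weights: "finite (weights j)"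
proof -
  have "weights j \<subseteq> (\<lambda>i. real i - j) ` {..nat \<lfloor>2 * j\<rfloor>}"
  proof
    fix m assume "m \<in> weights j"
    then obtain x y where x: "j - m = real x" "j + m = real y" by (auto simp: weights_def elim!: Nats_cases)
    then have "m = real y - j" "2 * j = real (x + y)" by auto
    then show "m \<in> (\<lambda>i. real i - j) ` {..nat \<lfloor>2 * j\<rfloor>}" by simp
  qed
  then show ?thesis by (rule finite_subset) simp
qed

lemma rfact_0 [simp]: "rfact 0 = 1"
  using rfact_of_nat[of 0] by simp

lemma rfact_Suc: "x \<in> \<nat> \<Longrightarrow> rfact (x + 1) = (x + 1) * rfact x"
proof -
  assume "x \<in> \<nat>"
  then obtain n where "x = real n" by (auto elim: Nats_cases)
  then show ?thesis using rfact_of_nat[of "Suc n"] by (simp add: add.commute)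
qed

section \<open>The tensor product action in coordinates\<close>

lemma cop_act_J_zero:
  assumes supp: "\<forall>m1 m2. v (m1, m2) \<noteq> 0 \<longrightarrow> m1 \<in> weights j1 \<and> m2 \<in> weights j2"
  shows "cop_act J_zero j1 j2 v (n1, n2) = 2 * (n1 + n2) * v (n1, n2)"
proof (cases "n1 \<in> weights j1 \<and> n2 \<in> weights j2")
  case True
  have "(\<Sum>m1\<in>weights j1. J_zero j1 n1 m1 * v (m1, n2)) = (\<Sum>m1\<in>weights j1. if m1 = n1 then 2 * n1 * v (n1, n2) else 0)"
    by (rule sum.cong) (auto simp: J_zero_def)
  moreover have "(\<Sum>m2\<in>weights j2. J_zero j2 n2 m2 * v (n1, m2)) = (\<Sum>m2\<in>weights j2. if m2 = n2 then 2 * n2 * v (n1, n2) else 0)"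
    by (rule sum.cong) (auto simp: J_zero_def)
  ultimately show ?thesis using True by (simp add: cop_act_def finite_weights algebra_simps)
next
  case False
  have z: "J_zero j1 n1 m1 * v (m1, n2) = 0" "J_zero j2 n2 m2 * v (n1, m2) = 0" for m1 m2
    using False supp by (auto simp: J_zero_def)
  have "v (n1, n2) = 0" using False supp by blast
  then show ?thesis unfolding cop_act_def split_conv z sum.neutral_const by simp
qed

lemma cop_act_J_plus:
  assumes supp: "\<forall>m1 m2. v (m1, m2) \<noteq> 0 \<longrightarrow> m1 \<in> weights j1 \<and> m2 \<in> weights j2"
  shows "cop_act J_plus j1 j2 v (n1, n2) = (if n1 \<in> weights j1 \<and> n2 \<in> weights j2
    then sqrt ((j1 - n1 + 1) * (j1 + n1)) * v (n1 - 1, n2) + sqrt ((j2 - n2 + 1) * (j2 + n2)) * v (n1, n2 - 1)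
    else 0)"
proof (cases "n1 \<in> weights j1 \<and> n2 \<in> weights j2")
  case True
  have "(\<Sum>m1\<in>weights j1. J_plus j1 n1 m1 * v (m1, n2)) =
      (\<Sum>m1\<in>weights j1. if m1 = n1 - 1 then sqrt ((j1 - n1 + 1) * (j1 + n1)) * v (n1 - 1, n2) else 0)"
    using True by (intro sum.cong) (auto simp: J_plus_def)
  also have "\<dots> = sqrt ((j1 - n1 + 1) * (j1 + n1)) * v (n1 - 1, n2)"
    using supp by (auto simp: finite_weights)
  finally have 1: "(\<Sum>m1\<in>weights j1. J_plus j1 n1 m1 * v (m1, n2)) = \<dots>" .
  have "(\<Sum>m2\<in>weights j2. J_plus j2 n2 m2 * v (n1, m2)) =
      (\<Sum>m2\<in>weights j2. if m2 = n2 - 1 then sqrt ((j2 - n2 + 1) * (j2 + n2)) * v (n1, n2 - 1) else 0)"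
    using True by (intro sum.cong) (auto simp: J_plus_def)
  also have "\<dots> = sqrt ((j2 - n2 + 1) * (j2 + n2)) * v (n1, n2 - 1)"
    using supp by (auto simp: finite_weights)
  finally show ?thesis using 1 True by (simp add: cop_act_def)
next
  case False
  have z: "J_plus j1 n1 m1 * v (m1, n2) = 0" "J_plus j2 n2 m2 * v (n1, m2) = 0" for m1 m2
    using False supp by (auto simp: J_plus_def)
  have "cop_act J_plus j1 j2 v (n1, n2) = 0" unfolding cop_act_def split_conv z sum.neutral_const by simp
  then show ?thesis using False by auto
qed

lemma cop_act_J_minus:
  assumes supp: "\<forall>m1 m2. v (m1, m2) \<noteq> 0 \<longrightarrow> m1 \<in> weights j1 \<and> m2 \<in> weights j2"
  shows "cop_act J_minus j1 j2 v (n1, n2) = (if n1 \<in> weights j1 \<and> n2 \<in> weights j2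
    then sqrt ((j1 + n1 + 1) * (j1 - n1)) * v (n1 + 1, n2) + sqrt ((j2 + n2 + 1) * (j2 - n2)) * v (n1, n2 + 1)
    else 0)"
proof (cases "n1 \<in> weights j1 \<and> n2 \<in> weights j2")
  case True
  have "(\<Sum>m1\<in>weights j1. J_minus j1 n1 m1 * v (m1, n2)) =
      (\<Sum>m1\<in>weights j1. if m1 = n1 + 1 then sqrt ((j1 + n1 + 1) * (j1 - n1)) * v (n1 + 1, n2) else 0)"
    using True by (intro sum.cong) (auto simp: J_minus_def algebra_simps)
  also have "\<dots> = sqrt ((j1 + n1 + 1) * (j1 - n1)) * v (n1 + 1, n2)"
    using supp by (auto simp: finite_weights)
  finally have 1: "(\<Sum>m1\<in>weights j1. J_minus j1 n1 m1 * v (m1, n2)) = \<dots>" .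
  have "(\<Sum>m2\<in>weights j2. J_minus j2 n2 m2 * v (n1, m2)) =
      (\<Sum>m2\<in>weights j2. if m2 = n2 + 1 then sqrt ((j2 + n2 + 1) * (j2 - n2)) * v (n1, n2 + 1) else 0)"
    using True by (intro sum.cong) (auto simp: J_minus_def algebra_simps)
  also have "\<dots> = sqrt ((j2 + n2 + 1) * (j2 - n2)) * v (n1, n2 + 1)"
    using supp by (auto simp: finite_weights)
  finally show ?thesis using 1 True by (simp add: cop_act_def)
next
  case False
  have z: "J_minus j1 n1 m1 * v (m1, n2) = 0" "J_minus j2 n2 m2 * v (n1, m2) = 0" for m1 m2
    using False supp by (auto simp: J_minus_def)
  have "cop_act J_minus j1 j2 v (n1, n2) = 0" unfolding cop_act_def split_conv z sum.neutral_const by simp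
  then show ?thesis using False by auto
qed

lemma cop_act_scale: "cop_act J j1 j2 (\<lambda>p. c * v p) = (\<lambda>p. c * cop_act J j1 j2 v p)"
  by (auto simp: cop_act_def sum_distrib_left algebra_simps)

lemma cop_act_diff: "cop_act J j1 j2 (\<lambda>p. v p - w p) = (\<lambda>p. cop_act J j1 j2 v p - cop_act J j1 j2 w p)"
  by (auto simp: cop_act_def sum_subtractf algebra_simps)

section \<open>Uniqueness of the highest weight vector\<close>

definition is_cg_highest :: "real \<Rightarrow> real \<Rightarrow> real \<Rightarrow> (real \<times> real \<Rightarrow> real) \<Rightarrow> bool" where
  "is_cg_highest j1 j2 k v \<longleftrightarrow>
     (\<forall>m1 m2. v (m1, m2) \<noteq> 0 \<longrightarrow> m1 \<in> weights j1 \<and> m2 \<in> weights j2) \<and>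
     cop_act J_zero j1 j2 v = (\<lambda>p. 2 * k * v p) \<and>
     cop_act J_plus j1 j2 v = (\<lambda>p. 0) \<and>
     (\<Sum>p\<in>weights j1 \<times> weights j2. (v p)\<^sup>2) = 1 \<and>
     v (j1, k - j1) > 0"

text \<open>\<open>J\<^sub>+ d = 0\<close> determines each coefficient from its neighbour, starting at the top one.\<close>

lemma highest_vector_eq_0:
  assumes supp: "\<forall>m1 m2. d (m1, m2) \<noteq> 0 \<longrightarrow> m1 \<in> weights j1 \<and> m2 \<in> weights j2"
    and d0: "cop_act J_zero j1 j2 d = (\<lambda>p. 2 * k * d p)"
    and dplus: "cop_act J_plus j1 j2 d = (\<lambda>p. 0)"
    and top: "d (j1, k - j1) = 0"
  shows "d p = 0"
proof (rule ccontr)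
  obtain m1 m2 where p: "p = (m1, m2)" by fastforce
  \<comment> \<open>Every index pair of total weight \<open>k\<close> is of this form, with
    \<open>i = j1 - m1\<close>.\<close>
  have line: "d (j1 - real i, k - j1 + real i) = 0" for i
  proof (induction i)
    case 0
    then show ?case using top by simp
  next
    case (Suc i)
    show ?case
    proof (rule ccontr)
      let ?m1 = "j1 - real (Suc i)" and ?m2 = "k - j1 + real (Suc i)"
      assume nz: "d (?m1, ?m2) \<noteq> 0"
      then have w: "?m1 \<in> weights j1" "?m2 \<in> weights j2" using supp by blast+
      then have m1: "j1 + ?m1 \<in> \<nat>" by (simp add: weights_def)
      then have nn: "j1 + ?m1 \<ge> 0" by (auto elim: Nats_cases)
      have "j1 + (?m1 + 1) \<in> \<nat>" using Nats_add[OF m1 Nats_1] by (simp add: algebra_simps)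
      moreover have "j1 - (?m1 + 1) \<in> \<nat>" by simp
      ultimately have w': "?m1 + 1 \<in> weights j1" by (simp add: weights_def)
      have e: "?m1 + 1 - 1 = ?m1" by simp
      \<comment> \<open>At a point of total weight \<open>k + 1\<close> the equation couples the
        unknown component to the one known by induction, and the coefficient of the unknown is
        nonzero.\<close>
      have "cop_act J_plus j1 j2 d (?m1 + 1, ?m2) = 0" using dplus by simp
      moreover have "d (?m1 + 1, ?m2 - 1) = 0" using Suc.IH by (simp add: algebra_simps)
      ultimately have "sqrt ((j1 - (?m1 + 1) + 1) * (j1 + (?m1 + 1))) * d (?m1, ?m2) = 0"
        using w w' unfolding cop_act_J_plus[OF supp] e by simp
      moreover have "(j1 - (?m1 + 1) + 1) * (j1 + (?m1 + 1)) > 0"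
        using nn by (intro mult_pos_pos) auto
      ultimately show False using nz by simp
    qed
  qed
  assume nz: "d p \<noteq> 0"
  have "2 * (m1 + m2) * d p = 2 * k * d p"
    using fun_cong[OF d0, of "(m1, m2)"] cop_act_J_zero[of d j1 j2 m1 m2] supp by (auto simp: p)
  then have "m1 + m2 = k" using nz by simp
  moreover obtain i where "j1 - m1 = real i"
    using supp nz by (auto simp: weights_def p elim!: Nats_cases)
  then have "m1 = j1 - real i" by simp
  ultimately have "p = (j1 - real i, k - j1 + real i)" by (auto simp: p)
  then show False using line nz by simp
qed

text \<open>The combination that cancels the top components is again a highest weight vector, hence
  zero. So the two vectors are proportional, and unit norm with positivity at the top fixes the
  ratio.\<close>

lemma is_cg_highest_unique:
  assumes v: "is_cg_highest j1 j2 k v" and w: "is_cg_highest j1 j2 k w"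
  shows "v = w"
proof -
  let ?t = "(j1, k - j1)"
  let ?d = "\<lambda>p. w ?t * v p - v ?t * w p"
  have d: "?d p = 0" for p
  proof (rule highest_vector_eq_0[where k = k])
    show "\<forall>m1 m2. ?d (m1, m2) \<noteq> 0 \<longrightarrow> m1 \<in> weights j1 \<and> m2 \<in> weights j2"
    proof (intro allI impI)
      fix m1 m2 assume "?d (m1, m2) \<noteq> 0"
      then have "v (m1, m2) \<noteq> 0 \<or> w (m1, m2) \<noteq> 0" by auto
      then show "m1 \<in> weights j1 \<and> m2 \<in> weights j2" using v w unfolding is_cg_highest_def by blast
    qed
    show "cop_act J_zero j1 j2 ?d = (\<lambda>p. 2 * k * ?d p)"
      unfolding cop_act_diff cop_act_scale
      using v w by (simp add: is_cg_highest_def right_diff_distrib mult_ac)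
    show "cop_act J_plus j1 j2 ?d = (\<lambda>p. 0)"
      unfolding cop_act_diff cop_act_scale using v w by (simp add: is_cg_highest_def)
  qed simp
  have pos: "v ?t > 0" "w ?t > 0" using v w by (simp_all add: is_cg_highest_def)
  define c where "c = w ?t / v ?t"
  have wv: "w p = c * v p" for p using d[of p] pos by (simp add: c_def field_simps)
  have "(\<Sum>p\<in>weights j1 \<times> weights j2. (w p)\<^sup>2) = c\<^sup>2 * (\<Sum>p\<in>weights j1 \<times> weights j2. (v p)\<^sup>2)"
    by (simp add: wv power_mult_distrib sum_distrib_left)
  then have "c\<^sup>2 = 1" using v w by (simp add: is_cg_highest_def)
  moreover have "c > 0" using pos by (simp add: c_def)
  ultimately have "c = 1" by (simp add: power2_eq_1_iff)
  then show ?thesis using wv by (simp add: fun_eq_iff)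
qed

lemma cg_highest_eqI: "is_cg_highest j1 j2 k v \<Longrightarrow> cg_highest j1 j2 k = v"
  unfolding cg_highest_def is_cg_highest_def[symmetric]
  using is_cg_highest_unique by blast

text \<open>The vector \<open>|k m\<rangle>\<close>, up to a normalization that depends only on \<open>j1\<close>, \<open>j2\<close>, \<open>k\<close>.\<close>

definition racah_vec :: "real \<Rightarrow> real \<Rightarrow> real \<Rightarrow> real \<Rightarrow> real \<times> real \<Rightarrow> real" where
  "racah_vec j1 j2 k m = (\<lambda>(m1, m2). if m1 \<in> weights j1 \<and> m2 \<in> weights j2 \<and> m1 + m2 = m
     then sqrt (rfact (j1 + m1) * rfact (j1 - m1) * rfact (j2 + m2) * rfact (j2 - m2) * rfact (k + m) * rfact (k - m))
       * racah_sum (nat \<lfloor>j1 + j2 - k\<rfloor>) (j1 + m1) (j1 - m1) (j2 + m2) (j2 - m2) else 0)"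

lemma racah_vec_supp: "\<forall>m1 m2. racah_vec j1 j2 k m (m1, m2) \<noteq> 0 \<longrightarrow> m1 \<in> weights j1 \<and> m2 \<in> weights j2"
  by (auto simp: racah_vec_def split: if_splits)

text \<open>The root in a matrix element of \<open>J_plus\<close> or \<open>J_minus\<close> combines
  with the root of factorials in \<open>racah_vec\<close> to the integer factor found in
  \<open>racah_sum_raise\<close> or \<open>racah_sum_lower\<close>.\<close>

lemma sqrt_rfact_shift:
  assumes "x \<in> \<nat>" "y \<in> \<nat>" "y \<noteq> 0"
  shows "sqrt ((x + 1) * y) * sqrt (rfact (x + 1) * rfact (y - 1) * X) = (x + 1) * sqrt (rfact x * rfact y * X)"
proof -
  have x: "x \<ge> 0" using assms by (auto elim: Nats_cases)
  obtain n where "y = real n" using assms by (auto elim: Nats_cases)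
  then have "y - 1 = real (n - 1)" using assms by (cases n) auto
  then have "y - 1 \<in> \<nat>" by simp
  then have "rfact y = y * rfact (y - 1)" using rfact_Suc[of "y - 1"] by simp
  then have "((x + 1) * y) * (rfact (x + 1) * rfact (y - 1) * X) = (x + 1)\<^sup>2 * (rfact x * rfact y * X)"
    using rfact_Suc[OF assms(1)] by (simp add: power2_eq_square mult_ac)
  then show ?thesis using x by (simp only: real_sqrt_mult[symmetric]) (simp add: real_sqrt_mult)
qed

lemma Nats_minus_1: "x \<in> \<nat> \<Longrightarrow> x \<noteq> 0 \<Longrightarrow> x - 1 \<in> (\<nat> :: real set)"
  by (metis Nats_cases Nats_diff of_nat_0 of_nat_1 One_nat_def Suc_leI gr0I of_nat_diff of_nat_in_Nats)

lemma weights_minus: "m \<in> weights j \<Longrightarrow> j + m \<noteq> 0 \<Longrightarrow> m - 1 \<in> weights j"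
proof -
  assume m: "m \<in> weights j" "j + m \<noteq> 0"
  then have "j - m + 1 \<in> \<nat>" "j + m - 1 \<in> \<nat>" by (auto simp: weights_def Nats_minus_1)
  then show ?thesis by (simp add: weights_def algebra_simps)
qed

lemma weights_plus: "m \<in> weights j \<Longrightarrow> j - m \<noteq> 0 \<Longrightarrow> m + 1 \<in> weights j"
proof -
  assume m: "m \<in> weights j" "j - m \<noteq> 0"
  then have "j + m + 1 \<in> \<nat>" "j - m - 1 \<in> \<nat>" by (auto simp: weights_def Nats_minus_1)
  then show ?thesis by (simp add: weights_def algebra_simps)
qed

lemma Nats_Ints: "x \<in> \<nat> \<Longrightarrow> x \<in> (\<int> :: real set)"
  by (auto elim: Nats_cases)

text \<open>Vandermonde's convolution with negative upper indices, by C(b+i, i) = (-1)^i C(-b-1,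
  i).\<close>

lemma sum_binomial_products:
  "(\<Sum>i\<le>n. real ((b + i) choose i) * real ((c + (n - i)) choose (n - i))) = real ((b + c + n + 1) choose n)"
proof -
  have neg: "real ((b + i) choose i) = (-1) ^ i * ((- real b - 1) gchoose i)" for b i
    using gbinomial_negated_upper[of "real (b + i)" i] by (simp add: binomial_gbinomial)
  have "(\<Sum>i\<le>n. real ((b + i) choose i) * real ((c + (n - i)) choose (n - i)))
    = (\<Sum>i\<le>n. (-1) ^ n * (((- real b - 1) gchoose i) * ((- real c - 1) gchoose (n - i))))"
  proof (rule sum.cong[OF refl])
    fix i assume "i \<in> {..n}"
    then have "(-1 :: real) ^ n = (-1) ^ i * (-1) ^ (n - i)" by (simp flip: power_add)
    then show "real ((b + i) choose i) * real ((c + (n - i)) choose (n - i))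
        = (-1) ^ n * (((- real b - 1) gchoose i) * ((- real c - 1) gchoose (n - i)))"
      unfolding neg by simp
  qed
  also have "\<dots> = (-1) ^ n * ((- real b - 1 + (- real c - 1)) gchoose n)"
    using gbinomial_Vandermonde[of "- real b - 1" "- real c - 1" n]
    by (simp only: sum_distrib_left[symmetric] atLeast0AtMost)
  also have "\<dots> = real ((b + c + 1 + n) choose n)"
    unfolding neg by (simp add: algebra_simps)
  finally show ?thesis by (simp add: add_ac)
qed

section \<open>Racah's formula for three spins obeying the triangle rule\<close>

context
  fixes j1 j2 k :: real and r \<alpha> \<beta> :: nat
  assumes j1: "2 * j1 = real (r + \<alpha>)" and j2: "2 * j2 = real (r + \<beta>)" and k: "2 * k = real (\<alpha> + \<beta>)"
begin

text \<open>The naturals \<open>r\<close>, \<open>\<alpha>\<close>, \<open>\<beta>\<close>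
  parametrize the admissible triples of spins; they are the arguments of the three factorials in the
  denominator of \<open>nabla k j2 j1\<close>.\<close>

lemma triangle: "j1 + j2 - k = real r" "k + j1 - j2 = real \<alpha>" "k + j2 - j1 = real \<beta>"
  using j1 j2 k by (auto simp: field_simps)

lemma racah_vec_lower:
  assumes m: "m \<in> weights k" "k + m \<noteq> 0"
  shows "cop_act J_minus j1 j2 (racah_vec j1 j2 k m) = (\<lambda>p. sqrt ((k + m) * (k - m + 1)) * racah_vec j1 j2 k (m - 1) p)"
proof (intro ext, clarify)
  fix n1 n2
  let ?V = "racah_vec j1 j2 k m"
  show "cop_act J_minus j1 j2 ?V (n1, n2) = sqrt ((k + m) * (k - m + 1)) * racah_vec j1 j2 k (m - 1) (n1, n2)"
  proof (cases "n1 \<in> weights j1 \<and> n2 \<in> weights j2 \<and> n1 + n2 = m - 1")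
    case False
    then show ?thesis by (auto simp: cop_act_J_minus racah_vec_supp) (auto simp: racah_vec_def)
  next
    case True
    define q1 p1 q2 p2 where qp: "q1 = j1 + n1" "p1 = j1 - n1" "q2 = j2 + n2" "p2 = j2 - n2"
    have nats: "q1 \<in> \<nat>" "p1 \<in> \<nat>" "q2 \<in> \<nat>" "p2 \<in> \<nat>" using True by (auto simp: weights_def qp)
    have w: "k - m \<in> \<nat>" "k + m \<in> \<nat>" using m by (auto simp: weights_def)
    let ?E = "racah_sum r"
    let ?A = "sqrt (rfact q1 * rfact p1 * rfact q2 * rfact p2 * rfact (k + m) * rfact (k - m))"
    have 1: "sqrt ((q1 + 1) * p1) * ?V (n1 + 1, n2) = ?A * ((q1 + 1) * ?E (q1 + 1) (p1 - 1) q2 p2)"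
    \<comment> \<open>At the top of the ladder the root on the left is zero, and the Racah sum on
      the right has the argument -1.\<close>
    proof (cases "p1 = 0")
      case True
      then show ?thesis by (simp add: racah_sum_neg)
    next
      case p1: False
      have "?V (n1 + 1, n2) = sqrt (rfact (q1 + 1) * rfact (p1 - 1) * (rfact q2 * rfact p2 * rfact (k + m) * rfact (k - m)))
          * ?E (q1 + 1) (p1 - 1) q2 p2"
        using True p1 weights_plus[of n1 j1] by (simp add: racah_vec_def triangle qp algebra_simps)
      then show ?thesis
        using sqrt_rfact_shift[OF nats(1,2) p1, of "rfact q2 * rfact p2 * rfact (k + m) * rfact (k - m)"]
        by (simp add: mult_ac)
    qed
    have 2: "sqrt ((q2 + 1) * p2) * ?V (n1, n2 + 1) = ?A * ((q2 + 1) * ?E q1 p1 (q2 + 1) (p2 - 1))"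
    proof (cases "p2 = 0")
      case True
      then show ?thesis by (simp add: racah_sum_neg)
    next
      case p2: False
      have "?V (n1, n2 + 1) = sqrt (rfact (q2 + 1) * rfact (p2 - 1) * (rfact q1 * rfact p1 * rfact (k + m) * rfact (k - m)))
          * ?E q1 p1 (q2 + 1) (p2 - 1)"
        using True p2 weights_plus[of n2 j2] by (simp add: racah_vec_def triangle qp algebra_simps)
      then show ?thesis
        using sqrt_rfact_shift[OF nats(3,4) p2, of "rfact q1 * rfact p1 * rfact (k + m) * rfact (k - m)"]
        by (simp add: mult_ac)
    qed
    have "sqrt ((k + m) * (k - m + 1)) * sqrt (rfact (k - m + 1) * rfact (k + m - 1) * (rfact q1 * rfact p1 * rfact q2 * rfact p2))
        = (k - m + 1) * sqrt (rfact (k - m) * rfact (k + m) * (rfact q1 * rfact p1 * rfact q2 * rfact p2))"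
      using sqrt_rfact_shift[OF w m(2)] by (simp only: mult.commute[of "k + m"])
    moreover have "racah_vec j1 j2 k (m - 1) (n1, n2) =
        sqrt (rfact (k - m + 1) * rfact (k + m - 1) * (rfact q1 * rfact p1 * rfact q2 * rfact p2)) * ?E q1 p1 q2 p2"
      using True by (simp add: racah_vec_def triangle qp algebra_simps)
    ultimately have 3: "sqrt ((k + m) * (k - m + 1)) * racah_vec j1 j2 k (m - 1) (n1, n2) = ?A * ((k - m + 1) * ?E q1 p1 q2 p2)"
      by (simp add: mult_ac)
    have "p1 + p2 - real r = k - m + 1" using True triangle by (simp add: qp algebra_simps)
    then have "?A * ((q1 + 1) * ?E (q1 + 1) (p1 - 1) q2 p2) + ?A * ((q2 + 1) * ?E q1 p1 (q2 + 1) (p2 - 1))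
        = ?A * ((k - m + 1) * ?E q1 p1 q2 p2)"
      using racah_sum_lower[of q1 p1 q2 p2 r] nats by (simp add: Nats_Ints distrib_left[symmetric])
    then show ?thesis
      using True 1 2 3 by (simp add: cop_act_J_minus racah_vec_supp qp)
  qed
qed

text \<open>Only components of total weight \<open>k + 1\<close> are in question. There
  \<open>p1 + p2 = r - 1\<close>, so the Racah sum on the right of \<open>racah_sum_raise\<close>
  vanishes.\<close>

lemma racah_vec_highest: "cop_act J_plus j1 j2 (racah_vec j1 j2 k k) = (\<lambda>p. 0)"
proof (intro ext, clarify)
  fix n1 n2
  let ?V = "racah_vec j1 j2 k k"
  show "cop_act J_plus j1 j2 ?V (n1, n2) = 0"
  proof (cases "n1 \<in> weights j1 \<and> n2 \<in> weights j2 \<and> n1 + n2 = k + 1")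
    case False
    then show ?thesis by (auto simp: cop_act_J_plus racah_vec_supp) (auto simp: racah_vec_def)
  next
    case True
    define q1 p1 q2 p2 where qp: "q1 = j1 + n1" "p1 = j1 - n1" "q2 = j2 + n2" "p2 = j2 - n2"
    have nats: "q1 \<in> \<nat>" "p1 \<in> \<nat>" "q2 \<in> \<nat>" "p2 \<in> \<nat>" using True by (auto simp: weights_def qp)
    let ?E = "racah_sum r"
    let ?A = "sqrt (rfact q1 * rfact p1 * rfact q2 * rfact p2 * rfact (k + k))"
    have 1: "sqrt ((p1 + 1) * q1) * ?V (n1 - 1, n2) = ?A * ((p1 + 1) * ?E (q1 - 1) (p1 + 1) q2 p2)"
    proof (cases "q1 = 0")
      case True
      then show ?thesis by (simp add: racah_sum_neg)
    next
      case q1: False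
      have "?V (n1 - 1, n2) = sqrt (rfact (p1 + 1) * rfact (q1 - 1) * (rfact q2 * rfact p2 * rfact (k + k)))
          * ?E (q1 - 1) (p1 + 1) q2 p2"
        using True q1 weights_minus[of n1 j1] rfact_of_nat[of 0] by (simp add: racah_vec_def triangle qp algebra_simps)
      then show ?thesis
        using sqrt_rfact_shift[OF nats(2,1) q1, of "rfact q2 * rfact p2 * rfact (k + k)"]
        by (simp add: mult_ac)
    qed
    have 2: "sqrt ((p2 + 1) * q2) * ?V (n1, n2 - 1) = ?A * ((p2 + 1) * ?E q1 p1 (q2 - 1) (p2 + 1))"
    proof (cases "q2 = 0")
      case True
      then show ?thesis by (simp add: racah_sum_neg)
    next
      case q2: False
      have "?V (n1, n2 - 1) = sqrt (rfact (p2 + 1) * rfact (q2 - 1) * (rfact q1 * rfact p1 * rfact (k + k)))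
          * ?E q1 p1 (q2 - 1) (p2 + 1)"
        using True q2 weights_minus[of n2 j2] rfact_of_nat[of 0] by (simp add: racah_vec_def triangle qp algebra_simps)
      then show ?thesis
        using sqrt_rfact_shift[OF nats(4,3) q2, of "rfact q1 * rfact p1 * rfact (k + k)"]
        by (simp add: mult_ac)
    qed
    have "p1 + p2 < real r" using True triangle by (simp add: qp)
    then have "?E q1 p1 q2 p2 = 0" by (simp add: racah_sum_eq_0)
    then have "?A * ((p1 + 1) * ?E (q1 - 1) (p1 + 1) q2 p2) + ?A * ((p2 + 1) * ?E q1 p1 (q2 - 1) (p2 + 1)) = 0"
      using racah_sum_raise[of q1 p1 q2 p2 r] nats by (simp add: Nats_Ints distrib_left[symmetric])
    then show ?thesis
      using True 1 2 by (simp add: cop_act_J_plus racah_vec_supp qp)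
  qed
qed

text \<open>Here \<open>p1 = i\<close> and \<open>p2 = r - i\<close>, so the factors 1/(p1 - v)! and
  1/(p2 - (r - v))! leave only the term \<open>v = i\<close>.\<close>

lemma racah_vec_top:
  assumes i: "i \<le> r"
  shows "racah_vec j1 j2 k k (j1 - real i, k - j1 + real i) =
    (-1) ^ i * sqrt (fact (\<alpha> + \<beta>) * (fact (\<alpha> + (r - i)) * fact (\<beta> + i)) / (fact i * fact (r - i))) / (fact \<alpha> * fact \<beta>)"
proof -
  let ?m1 = "j1 - real i" and ?m2 = "k - j1 + real i"
  have e: "j1 + ?m1 = real (\<alpha> + (r - i))" "j1 - ?m1 = real i" "j2 + ?m2 = real (\<beta> + i)" "j2 - ?m2 = real (r - i)"
    "k + k = real (\<alpha> + \<beta>)" "k - k = real 0"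
    using j1 j2 k i by (auto simp: field_simps of_nat_diff)
  have w: "?m1 \<in> weights j1" "?m2 \<in> weights j2" unfolding weights_def mem_Collect_eq e by simp_all
  have "racah_sum r (j1 + ?m1) (j1 - ?m1) (j2 + ?m2) (j2 - ?m2) =
     (\<Sum>v\<le>r. if v = i then (-1) ^ i / (fact (r - i) * fact i * fact \<alpha> * fact \<beta>) else 0)"
    unfolding racah_sum_def
  proof (rule sum.cong[OF refl])
    fix v assume "v \<in> {..r}"
    then have v: "v \<le> r" by simp
    consider "v = i" | "i < v" | "v < i" by linarith
    then show "(-1) ^ v * inv_rfact (real (r - v)) * inv_rfact (real v)
     * inv_rfact (j1 + ?m1 - real (r - v)) * inv_rfact (j1 - ?m1 - real v)
     * inv_rfact (j2 + ?m2 - real v) * inv_rfact (j2 - ?m2 - real (r - v))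
      = (if v = i then (-1) ^ i / (fact (r - i) * fact i * fact \<alpha> * fact \<beta>) else 0)"
    proof cases
      case 1
      then show ?thesis unfolding e by (simp add: inv_rfact_of_nat)
    next
      case 2
      then have "inv_rfact (j1 - ?m1 - real v) = 0" unfolding e by (simp add: inv_rfact_neg)
      then show ?thesis using 2 by simp
    next
      case 3
      then have "inv_rfact (j2 - ?m2 - real (r - v)) = 0" unfolding e using v i
        by (intro inv_rfact_neg) (simp add: of_nat_diff)
      then show ?thesis using 3 by simp
    qed
  qed
  also have "\<dots> = (-1) ^ i / (fact (r - i) * fact i * fact \<alpha> * fact \<beta>)" using i by simp
  finally have E: "racah_sum r (j1 + ?m1) (j1 - ?m1) (j2 + ?m2) (j2 - ?m2) = \<dots>" .
  have "racah_vec j1 j2 k k (?m1, ?m2) = sqrt (fact (\<alpha> + (r - i)) * fact i * fact (\<beta> + i) * fact (r - i) * fact (\<alpha> + \<beta>))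
      * ((-1) ^ i / (fact (r - i) * fact i * fact \<alpha> * fact \<beta>))"
    using w by (simp add: racah_vec_def triangle E[unfolded e] e del: of_nat_add)
  also have "\<dots> = sqrt ((fact i * fact (r - i))\<^sup>2 * (fact (\<alpha> + \<beta>) * (fact (\<alpha> + (r - i)) * fact (\<beta> + i)) / (fact i * fact (r - i))))
      * ((-1) ^ i / (fact (r - i) * fact i * fact \<alpha> * fact \<beta>))"
  proof -
    have "fact (\<alpha> + (r - i)) * fact i * fact (\<beta> + i) * fact (r - i) * fact (\<alpha> + \<beta>) =
        (fact i * fact (r - i))\<^sup>2 * (fact (\<alpha> + \<beta>) * (fact (\<alpha> + (r - i)) * fact (\<beta> + i)) / (fact i * fact (r - i) :: real))"
      by (simp add: power2_eq_square)
    then show ?thesis by (simp only:)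
  qed
  also have "\<dots> = (-1) ^ i * sqrt (fact (\<alpha> + \<beta>) * (fact (\<alpha> + (r - i)) * fact (\<beta> + i)) / (fact i * fact (r - i))) / (fact \<alpha> * fact \<beta>)"
    unfolding real_sqrt_mult[of "(_)\<^sup>2"] by simp
  finally show ?thesis .
qed

text \<open>By weight, only the \<open>r + 1\<close> components of \<open>racah_vec_top\<close>
  count. Their squares are, up to a common constant, products of two binomial coefficients.\<close>

lemma racah_vec_norm:
  "(\<Sum>p\<in>weights j1 \<times> weights j2. (racah_vec j1 j2 k k p)\<^sup>2) = (nabla k j2 j1)\<^sup>2 / (2 * k + 1)"
proof -
  let ?f = "\<lambda>i. (j1 - real i, k - j1 + real i)"
  have "(\<Sum>p\<in>weights j1 \<times> weights j2. (racah_vec j1 j2 k k p)\<^sup>2) = (\<Sum>p\<in>?f ` {..r}. (racah_vec j1 j2 k k p)\<^sup>2)"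
  proof (rule sum.mono_neutral_right)
    show "?f ` {..r} \<subseteq> weights j1 \<times> weights j2"
    proof (rule image_subsetI)
      fix i assume "i \<in> {..r}"
      then have e: "j1 + (j1 - real i) = real (\<alpha> + (r - i))" "j1 - (j1 - real i) = real i"
        "j2 + (k - j1 + real i) = real (\<beta> + i)" "j2 - (k - j1 + real i) = real (r - i)"
        using j1 j2 k by (auto simp: field_simps of_nat_diff)
      have "j1 - real i \<in> weights j1 \<and> k - j1 + real i \<in> weights j2"
        unfolding weights_def mem_Collect_eq e by simp
      then show "?f i \<in> weights j1 \<times> weights j2" by simp
    qed
    show "\<forall>p\<in>weights j1 \<times> weights j2 - ?f ` {..r}. (racah_vec j1 j2 k k p)\<^sup>2 = 0"
    proof clarify
      fix m1 m2 assume m: "m1 \<in> weights j1" "m2 \<in> weights j2" "(m1, m2) \<notin> ?f ` {..r}"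
      show "(racah_vec j1 j2 k k (m1, m2))\<^sup>2 = 0"
      proof (rule ccontr)
        assume "\<not> ?thesis"
        then have s: "m1 + m2 = k" by (auto simp: racah_vec_def split: if_splits)
        obtain i l where il: "j1 - m1 = real i" "j2 - m2 = real l" using m by (auto simp: weights_def elim!: Nats_cases)
        then have "real i + real l = real r" using s triangle by simp
        then have "i \<le> r" by linarith
        moreover have "(m1, m2) = ?f i" using il s by auto
        ultimately show False using m by blast
      qed
    qed
  qed (simp add: finite_weights)
  also have "\<dots> = (\<Sum>i\<le>r. (racah_vec j1 j2 k k (?f i))\<^sup>2)"
    by (subst sum.reindex) (auto intro!: inj_onI)
  also have "\<dots> = (\<Sum>i\<le>r. fact (\<alpha> + \<beta>) / (fact \<alpha> * fact \<beta>) * (real ((\<beta> + i) choose i) * real ((\<alpha> + (r - i)) choose (r - i))))"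
  proof (rule sum.cong[OF refl])
    fix i assume "i \<in> {..r}"
    then have i: "i \<le> r" by simp
    have b: "real ((c + i) choose i) = fact (c + i) / (fact i * fact c)" for c i
      by (subst binomial_fact) simp_all
    show "(racah_vec j1 j2 k k (?f i))\<^sup>2 = fact (\<alpha> + \<beta>) / (fact \<alpha> * fact \<beta>) * (real ((\<beta> + i) choose i) * real ((\<alpha> + (r - i)) choose (r - i)))"
      unfolding racah_vec_top[OF i] b
      by (simp add: power_mult_distrib power_divide power_even_eq[symmetric] field_simps power2_eq_square flip: power_mult)
  qed
  also have "\<dots> = fact (\<alpha> + \<beta>) / (fact \<alpha> * fact \<beta>) * real ((\<beta> + \<alpha> + r + 1) choose r)"
    by (simp only: sum_distrib_left[symmetric] sum_binomial_products)
  also have "real ((\<beta> + \<alpha> + r + 1) choose r) = fact (\<alpha> + \<beta> + r + 1) / (fact r * fact (\<alpha> + \<beta> + 1))"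
    by (subst binomial_fact) (simp_all add: add_ac)
  also have "fact (\<alpha> + \<beta>) / (fact \<alpha> * fact \<beta>) * (fact (\<alpha> + \<beta> + r + 1) / (fact r * fact (\<alpha> + \<beta> + 1)))
    = fact (\<alpha> + \<beta> + r + 1) / (fact \<alpha> * fact \<beta> * fact r) / (real (\<alpha> + \<beta>) + 1)"
  proof -
    have "f / (x * y) * (g / (z * (s * f))) = g / (x * y * z) / s" if "f \<noteq> 0" for f g x y z s :: real
      using that by simp
    from this[of "fact (\<alpha> + \<beta>)"] show ?thesis by (simp add: add.commute)
  qed
  also have "\<dots> = (nabla k j2 j1)\<^sup>2 / (2 * k + 1)"
  proof -
    have e: "k + j2 + j1 + 1 = real (\<alpha> + \<beta> + r + 1)" "k + j2 - j1 = real \<beta>" "k - j2 + j1 = real \<alpha>" "- k + j2 + j1 = real r"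
      using j1 j2 k by (auto simp: field_simps)
    show ?thesis unfolding nabla_def e k rfact_of_nat by (simp add: mult_ac)
  qed
  finally show ?thesis .
qed

text \<open>The component \<open>(j1, k - j1)\<close> is the case \<open>i = 0\<close> of
  \<open>racah_vec_top\<close>, which carries no sign, so the Condon-Shortley phase holds. The order
  \<open>nabla k j2 j1\<close> suits the later use with \<open>j1 = j'\<close> and
  \<open>j2 = j\<close>.\<close>

lemma cg_highest_eq:
  "cg_highest j1 j2 k = (\<lambda>p. sqrt (2 * k + 1) / nabla k j2 j1 * racah_vec j1 j2 k k p)"
proof (rule cg_highest_eqI)
  have k0: "2 * k + 1 > 0" using k by simp
  have n0: "nabla k j2 j1 > 0" by (simp add: nabla_def rfact_pos)
  let ?c = "sqrt (2 * k + 1) / nabla k j2 j1"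
  have c0: "?c > 0" using k0 n0 by simp
  have z: "cop_act J_zero j1 j2 (racah_vec j1 j2 k k) = (\<lambda>p. 2 * k * racah_vec j1 j2 k k p)"
    by (intro ext, clarify, subst cop_act_J_zero[OF racah_vec_supp]) (auto simp: racah_vec_def)
  have "(\<Sum>p\<in>weights j1 \<times> weights j2. (?c * racah_vec j1 j2 k k p)\<^sup>2)
     = ?c\<^sup>2 * ((nabla k j2 j1)\<^sup>2 / (2 * k + 1))"
    by (simp only: power_mult_distrib sum_distrib_left[symmetric] racah_vec_norm)
  also have "\<dots> = 1" using k0 n0 by (simp add: power_divide)
  finally have norm: "(\<Sum>p\<in>weights j1 \<times> weights j2. (?c * racah_vec j1 j2 k k p)\<^sup>2) = 1" .
  have "racah_vec j1 j2 k k (j1, k - j1) > 0" using racah_vec_top[of 0] by simp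
  then show "is_cg_highest j1 j2 k (\<lambda>p. ?c * racah_vec j1 j2 k k p)"
    unfolding is_cg_highest_def cop_act_scale z racah_vec_highest norm
    using mult_pos_pos[OF c0] racah_vec_supp[of j1 j2 k k] by auto
qed

text \<open>The constant is the product of the roots of (2k - i)(i + 1) for i < n.\<close>

lemma racah_vec_lower_iterate:
  assumes "n \<le> \<alpha> + \<beta>"
  shows "(cop_act J_minus j1 j2 ^^ n) (racah_vec j1 j2 k k) =
    (\<lambda>p. sqrt (fact (\<alpha> + \<beta>) * fact n / fact (\<alpha> + \<beta> - n)) * racah_vec j1 j2 k (k - real n) p)"
  using assms
proof (induction n)
  case (Suc n)
  then have n: "n < \<alpha> + \<beta>" by simp
  have e: "k - (k - real n) = real n" "k + (k - real n) = real (\<alpha> + \<beta> - n)"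
    using k n by (auto simp: of_nat_diff)
  have w: "k - real n \<in> weights k" unfolding weights_def mem_Collect_eq e by simp
  have nz: "k + (k - real n) \<noteq> 0" unfolding e using n by simp
  obtain l where l: "\<alpha> + \<beta> - n = Suc l" using n by (metis Suc_diff_Suc)
  then have l': "\<alpha> + \<beta> - Suc n = l" by simp
  have "sqrt (fact (\<alpha> + \<beta>) * fact n / fact (\<alpha> + \<beta> - n)) * sqrt ((k + (k - real n)) * (k - (k - real n) + 1))
    = sqrt (fact (\<alpha> + \<beta>) * fact (Suc n) / fact (\<alpha> + \<beta> - Suc n))"
  proof -
    have "x * y / (s * f) * (s * t) = x * (t * y) / f" if "s \<noteq> 0" for x y s f t :: real
      using that by simp
    from this[of "real (Suc l)" "fact (\<alpha> + \<beta>)" "fact n" "fact l" "real n + 1"] show ?thesis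
      unfolding e l l' real_sqrt_mult[symmetric] by (simp add: add.commute)
  qed
  moreover have "cop_act J_minus j1 j2 (racah_vec j1 j2 k (k - real n))
      = (\<lambda>p. sqrt ((k + (k - real n)) * (k - (k - real n) + 1)) * racah_vec j1 j2 k (k - real (Suc n)) p)"
    using racah_vec_lower[OF w nz] by (simp add: diff_diff_eq add.commute[of 1])
  ultimately show ?case
    using Suc by (simp add: cop_act_scale mult.assoc[symmetric] del: of_nat_Suc fact_Suc)
qed simp

lemma clebsch_gordan_eq:
  assumes m: "m \<in> weights k"
  shows "clebsch_gordan j1 j2 k m1 m2 m = sqrt (2 * k + 1) / nabla k j2 j1 * racah_vec j1 j2 k m (m1, m2)"
proof -
  have abs: "k - \<bar>j1 - j2\<bar> = (if j1 \<ge> j2 then real \<beta> else real \<alpha>)" using triangle by auto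
  have cond: "k - \<bar>j1 - j2\<bar> \<in> \<nat> \<and> j1 + j2 - k \<in> \<nat> \<and> m \<in> weights k"
    unfolding abs triangle using m by simp
  obtain n l where nl: "k - m = real n" "k + m = real l" using m by (auto simp: weights_def elim!: Nats_cases)
  have "real n + real l = real (\<alpha> + \<beta>)" using nl k by simp
  then have sum: "\<alpha> + \<beta> = n + l" by linarith
  have k2: "2 * k = real (n + l)" using k sum by simp
  have scale: "(cop_act J_minus j1 j2 ^^ i) (\<lambda>p. c * v p) = (\<lambda>p. c * (cop_act J_minus j1 j2 ^^ i) v p)" for i c v
    by (induction i) (simp_all add: cop_act_scale)
  have m': "k - real n = m" using nl by simp
  have "clebsch_gordan j1 j2 k m1 m2 m = sqrt (fact l / (fact (n + l) * fact n)) *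
      (sqrt (2 * k + 1) / nabla k j2 j1 * (sqrt (fact (n + l) * fact n / fact l) * racah_vec j1 j2 k m (m1, m2)))"
    unfolding clebsch_gordan_def if_P[OF cond] cg_highest_eq scale nl k2 rfact_of_nat
    using racah_vec_lower_iterate[of n] sum by (simp add: m')
  \<comment> \<open>The normalization in \<open>clebsch_gordan\<close> is the inverse of the
    constant from iterating \<open>J_minus\<close>.\<close>
  also have "\<dots> = sqrt (fact l / (fact (n + l) * fact n) * (fact (n + l) * fact n / fact l)) *
      (sqrt (2 * k + 1) / nabla k j2 j1 * racah_vec j1 j2 k m (m1, m2))"
    unfolding real_sqrt_mult by simp
  also have "fact l / (fact (n + l) * fact n) * (fact (n + l) * fact n / fact l) = (1::real)" by simp
  finally show ?thesis by simp
qed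

end

section \<open>Exponentials and the twist\<close>

text \<open>\<open>fps_at b f\<close> is \<open>f(h b)\<close>.\<close>

definition fps_at :: "'w::real_algebra_1 \<Rightarrow> real fps \<Rightarrow> 'w fps" where
  "fps_at b f = Abs_fps (\<lambda>n. (f $ n) *\<^sub>R b ^ n)"

lemma fps_at_nth: "fps_at b f $ n = (f $ n) *\<^sub>R b ^ n"
  by (simp add: fps_at_def)

lemma fps_at_1: "fps_at b 1 = 1"
  by (rule fps_ext) (simp add: fps_at_nth)

text \<open>Powers of the single element \<open>b\<close> commute, so substitution is multiplicative
  although \<open>'w\<close> may be noncommutative.\<close>

lemma fps_at_mult: "fps_at b (f * g) = fps_at b f * fps_at b g"
  by (rule fps_ext) (simp add: fps_at_nth fps_mult_nth scaleR_sum_left power_add[symmetric] mult.commute)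

lemma fps_at_power: "fps_at b (f ^ n) = fps_at b f ^ n"
  by (induction n) (simp_all add: fps_at_1 fps_at_mult)

lemma fps_at_uminus: "fps_at b (- f) = - fps_at b f"
  by (rule fps_ext) (simp add: fps_at_nth)

lemma of_real_fps_nth [simp]: "of_real_fps f $ n = of_real (f $ n)"
  by (simp add: of_real_fps_def)

lemma of_real_fps_oo_fps_at: "of_real_fps f oo fps_at b g = fps_at b (f oo g)"
  by (rule fps_ext)
    (simp add: fps_compose_nth fps_at_nth fps_at_power[symmetric] scaleR_sum_left scaleR_conv_of_real sum_distrib_right mult.assoc)

lemma fps_at_X: "fps_at b fps_X = fps_X * fps_const b"
proof (rule fps_ext)
  fix n show "fps_at b fps_X $ n = (fps_X * fps_const b) $ n"
    by (cases n) (auto simp: fps_at_nth fps_X_def fps_X_mult_nth)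
qed

text \<open>Both sides have constant term 1 and solve f' = c d f / (1 + X).\<close>

lemma fps_exp_oo_ln: "fps_exp c oo (fps_const d * fps_ln 1) = fps_binomial (c * d :: real)"
proof -
  let ?g = "fps_const d * fps_ln 1 :: real fps"
  have const: "(fps_const c * f) oo h = fps_const c * (f oo h)" for f h :: "real fps"
    by (rule fps_ext) (simp add: fps_compose_nth sum_distrib_left mult_ac)
  have "fps_deriv (fps_exp c oo ?g) = (fps_deriv (fps_exp c) oo ?g) * fps_deriv ?g"
    by (rule fps_compose_deriv) (simp add: fps_ln_def)
  also have "\<dots> = fps_const (c * d) * (fps_exp c oo ?g) / (1 + fps_X)"
    by (simp add: fps_ln_deriv const fps_divide_unit mult_ac flip: fps_const_mult)
  finally show ?thesis
    by (subst fps_binomial_ODE_unique'[symmetric]) simp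
qed

lemma exp_sigma_boson:
  "of_real_fps (fps_exp m) oo sigma_boson a = fps_at (a ^ 2) (fps_binomial (- m))"
  unfolding sigma_boson_def fps_at_X[symmetric] of_real_fps_oo_fps_at
  using fps_exp_oo_ln[of m "-1"]
  by (simp add: fps_at_uminus[symmetric] of_real_fps_oo_fps_at flip: fps_const_neg)

section \<open>Functions of matrices over power series\<close>

lemma hmat_mult_assoc: "finite I \<Longrightarrow> hmat_mult I (hmat_mult I A B) C = hmat_mult I A (hmat_mult I B C)"
  unfolding hmat_mult_def
  by (intro ext) (simp add: sum_distrib_left sum_distrib_right mult.assoc, subst sum.swap, simp)

text \<open>The support condition makes \<open>hmat_one\<close> neutral for every candidate, which
  is what the usual uniqueness argument for inverses rests on.\<close>

lemma hmat_inverse_eqI: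
  assumes I: "finite I" and supp: "\<And>x y. B x y \<noteq> 0 \<Longrightarrow> x \<in> I \<and> y \<in> I"
    and AB: "hmat_mult I A B = hmat_one I" and BA: "hmat_mult I B A = hmat_one I"
  shows "hmat_inverse I A = B"
  unfolding hmat_inverse_def
proof (rule the_equality, intro conjI)
  show "\<forall>x y. B x y \<noteq> 0 \<longrightarrow> x \<in> I \<and> y \<in> I" using supp by blast
  fix C assume C: "(\<forall>x y. C x y \<noteq> 0 \<longrightarrow> x \<in> I \<and> y \<in> I) \<and>
     hmat_mult I A C = hmat_one I \<and> hmat_mult I C A = hmat_one I"
  have one: "hmat_mult I (hmat_one I) D = D" "hmat_mult I D (hmat_one I) = D"
    if "\<And>x y. D x y \<noteq> 0 \<Longrightarrow> x \<in> I \<and> y \<in> I" for D :: "'a hmat"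
  proof -
    show "hmat_mult I (hmat_one I) D = D"
    proof (intro ext)
      fix x y
      have "hmat_mult I (hmat_one I) D x y = (\<Sum>z\<in>I. if z = x then D z y else 0)"
        unfolding hmat_mult_def hmat_one_def by (rule sum.cong) auto
      then show "hmat_mult I (hmat_one I) D x y = D x y" using I that[of x y] by auto
    qed
    show "hmat_mult I D (hmat_one I) = D"
    proof (intro ext)
      fix x y
      have "hmat_mult I D (hmat_one I) x y = (\<Sum>z\<in>I. if z = y then D x z else 0)"
        unfolding hmat_mult_def hmat_one_def by (rule sum.cong) auto
      then show "hmat_mult I D (hmat_one I) x y = D x y" using I that[of x y] by auto
    qed
  qed
  have "C = hmat_mult I C (hmat_mult I A B)" using one(2)[of C] C AB by simp
  also have "\<dots> = B" using C one(1)[of B] supp by (simp add: hmat_mult_assoc[OF I, symmetric])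
  finally show "C = B" .
qed (use AB BA in auto)

primrec mat_power :: "real set \<Rightarrow> (real \<Rightarrow> real \<Rightarrow> real) \<Rightarrow> nat \<Rightarrow> real \<Rightarrow> real \<Rightarrow> real" where
  "mat_power I A 0 x y = (if x \<in> I \<and> x = y then 1 else 0)"
| "mat_power I A (Suc k) x y = (\<Sum>z\<in>I. A x z * mat_power I A k z y)"

text \<open>\<open>hmat_at I A f\<close> is \<open>f(- 2 h A)\<close>, where \<open>h\<close> is \<^const>\<open>fps_X\<close>; the scaling is that of \<^const>\<open>sigma_spin\<close>.\<close>

definition hmat_at :: "real set \<Rightarrow> (real \<Rightarrow> real \<Rightarrow> real) \<Rightarrow> real fps \<Rightarrow> real hmat" where
  "hmat_at I A f = (\<lambda>x y. Abs_fps (\<lambda>n. f $ n * ((- 2) ^ n * mat_power I A n x y)))"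

lemma hmat_power_monom:
  "hmat_power I (\<lambda>x y. - 2 * fps_X * fps_const (A x y)) k x y
    = fps_const ((- 2) ^ k * mat_power I A k x y) * fps_X ^ k"
proof (induction k arbitrary: x)
  case (Suc k)
  have "hmat_power I (\<lambda>x y. - 2 * fps_X * fps_const (A x y)) (Suc k) x y =
    (\<Sum>z\<in>I. fps_const (- 2) * fps_X * fps_const (A x z) * (fps_const ((- 2) ^ k * mat_power I A k z y) * fps_X ^ k))"
    unfolding hmat_power.simps hmat_mult_def Suc.IH by (simp add: numeral_fps_const)
  also have "\<dots> = (\<Sum>z\<in>I. fps_const ((- 2) ^ Suc k * (A x z * mat_power I A k z y)) * fps_X ^ Suc k)"
    by (rule sum.cong[OF refl]) (simp only: power_Suc fps_const_mult[symmetric] mult_ac)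
  also have "\<dots> = fps_const ((- 2) ^ Suc k * mat_power I A (Suc k) x y) * fps_X ^ Suc k"
    by (rule fps_ext) (simp add: fps_sum_nth fps_X_power_mult_right_nth sum_distrib_left)
  finally show ?case .
qed (auto simp: hmat_one_def)

text \<open>The \<open>k\<close>-th power is a pure multiple of h^k, so only \<open>k = n\<close>
  contributes to the coefficient of h^n.\<close>

lemma hmat_compose_monom:
  "hmat_compose I f (\<lambda>x y. - 2 * fps_X * fps_const (A x y)) = hmat_at I A f"
proof (intro ext fps_ext)
  fix x y n
  have "hmat_compose I f (\<lambda>x y. - 2 * fps_X * fps_const (A x y)) x y $ n
    = (\<Sum>k = 0..n. if k = n then f $ n * ((- 2) ^ n * mat_power I A n x y) else 0)"
    unfolding hmat_compose_def hmat_power_monom fps_nth_Abs_fps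
    by (rule sum.cong) (auto simp: fps_X_power_iff)
  then show "hmat_compose I f (\<lambda>x y. - 2 * fps_X * fps_const (A x y)) x y $ n = hmat_at I A f x y $ n"
    by (simp add: hmat_at_def)
qed

lemma mat_power_supp:
  assumes "\<forall>x y. A x y \<noteq> 0 \<longrightarrow> x \<in> I \<and> y \<in> I"
  shows "mat_power I A k x y \<noteq> 0 \<Longrightarrow> x \<in> I \<and> y \<in> I"
proof (induction k arbitrary: x)
  case 0
  then show ?case by (auto split: if_splits)
next
  case (Suc k)
  then obtain z where "z \<in> I" "A x z * mat_power I A k z y \<noteq> 0"
    by (auto elim: sum.not_neutral_contains_not_neutral)
  then show ?case using assms Suc.IH[of z] by auto
qed

lemma mat_power_add:
  assumes I: "finite I" and supp: "\<forall>x y. A x y \<noteq> 0 \<longrightarrow> x \<in> I \<and> y \<in> I"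
  shows "mat_power I A (k + l) x y = (\<Sum>z\<in>I. mat_power I A k x z * mat_power I A l z y)"
proof (induction k arbitrary: x)
  case 0
  have "(\<Sum>z\<in>I. mat_power I A 0 x z * mat_power I A l z y) = (\<Sum>z\<in>I. if z = x then mat_power I A l z y else 0)"
    by (intro sum.cong) auto
  then show ?case using I mat_power_supp[OF supp, where k = l and x = x and y = y] by auto
next
  case (Suc k)
  have "mat_power I A (Suc k + l) x y = (\<Sum>w\<in>I. \<Sum>z\<in>I. A x w * (mat_power I A k w z * mat_power I A l z y))"
    by (simp add: Suc.IH sum_distrib_left)
  also have "\<dots> = (\<Sum>z\<in>I. \<Sum>w\<in>I. A x w * (mat_power I A k w z * mat_power I A l z y))"
    by (rule sum.swap)
  finally show ?case by (simp add: sum_distrib_right mult.assoc)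
qed

lemma hmat_at_1: "hmat_at I A 1 = hmat_one I"
  by (intro ext fps_ext) (auto simp: hmat_at_def hmat_one_def)

lemma hmat_at_mult:
  assumes I: "finite I" and supp: "\<forall>x y. A x y \<noteq> 0 \<longrightarrow> x \<in> I \<and> y \<in> I"
  shows "hmat_mult I (hmat_at I A f) (hmat_at I A g) = hmat_at I A (f * g)"
proof (intro ext fps_ext)
  fix x y n
  let ?M = "mat_power I A"
  have "hmat_mult I (hmat_at I A f) (hmat_at I A g) x y $ n = (\<Sum>z\<in>I. \<Sum>i=0..n.
      f $ i * ((- 2) ^ i * ?M i x z) * (g $ (n - i) * ((- 2) ^ (n - i) * ?M (n - i) z y)))"
    by (simp add: hmat_mult_def hmat_at_def fps_sum_nth fps_mult_nth)
  also have "\<dots> = (\<Sum>i=0..n. \<Sum>z\<in>I.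
      f $ i * ((- 2) ^ i * ?M i x z) * (g $ (n - i) * ((- 2) ^ (n - i) * ?M (n - i) z y)))"
    by (rule sum.swap)
  also have "\<dots> = (\<Sum>i=0..n. f $ i * g $ (n - i) * ((- 2) ^ n * ?M n x y))"
  proof (rule sum.cong[OF refl])
    fix i assume "i \<in> {0..n}"
    then have n: "n = i + (n - i)" by simp
    have "(- 2 :: real) ^ n * ?M n x y = (- 2) ^ i * (- 2) ^ (n - i) * (\<Sum>z\<in>I. ?M i x z * ?M (n - i) z y)"
      by (subst (1 2) n) (simp only: power_add mat_power_add[OF assms])
    then show "(\<Sum>z\<in>I. f $ i * ((- 2) ^ i * ?M i x z) * (g $ (n - i) * ((- 2) ^ (n - i) * ?M (n - i) z y)))
      = f $ i * g $ (n - i) * ((- 2) ^ n * ?M n x y)"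
      by (simp add: sum_distrib_left mult_ac)
  qed
  also have "\<dots> = hmat_at I A (f * g) x y $ n"
    by (simp add: hmat_at_def fps_mult_nth sum_distrib_right)
  finally show "hmat_mult I (hmat_at I A f) (hmat_at I A g) x y $ n = hmat_at I A (f * g) x y $ n" .
qed

text \<open>The block diagonal matrix \<open>\<Sum>\<^sub>m |m\<rangle>\<langle>m| \<otimes> F\<^sub>m(- 2 h A)\<close>: as \<open>J\<^sub>0\<close> is diagonal, the twist has this form.\<close>

definition hmat_block :: "real set \<Rightarrow> real set \<Rightarrow> (real \<Rightarrow> real \<Rightarrow> real) \<Rightarrow> (real \<Rightarrow> real fps) \<Rightarrow> (real \<times> real) hmat" where
  "hmat_block I I' A F = (\<lambda>(n, n') (m, m'). if m \<in> I \<and> n = m then hmat_at I' A (F m) n' m' else 0)"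

lemma hmat_block_1: "hmat_block I I' A (\<lambda>_. 1) = hmat_one (I \<times> I')"
  by (intro ext) (auto simp: hmat_block_def hmat_at_1, auto simp: hmat_one_def)

lemma hmat_block_mult:
  assumes "finite I" "finite I'" "\<forall>x y. A x y \<noteq> 0 \<longrightarrow> x \<in> I' \<and> y \<in> I'"
  shows "hmat_mult (I \<times> I') (hmat_block I I' A F) (hmat_block I I' A G) = hmat_block I I' A (\<lambda>m. F m * G m)"
proof (intro ext, clarify)
  fix n n' m m'
  have "hmat_mult (I \<times> I') (hmat_block I I' A F) (hmat_block I I' A G) (n, n') (m, m') =
    (\<Sum>z\<in>I. \<Sum>z'\<in>I'. hmat_block I I' A F (n, n') (z, z') * hmat_block I I' A G (z, z') (m, m'))"
    by (simp add: hmat_mult_def sum.cartesian_product)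
  also have "\<dots> = (\<Sum>z\<in>I. if z = m then (if n = m then hmat_mult I' (hmat_at I' A (F m)) (hmat_at I' A (G m)) n' m' else 0) else 0)"
    by (rule sum.cong) (auto simp: hmat_block_def hmat_mult_def)
  finally show "hmat_mult (I \<times> I') (hmat_block I I' A F) (hmat_block I I' A G) (n, n') (m, m')
      = hmat_block I I' A (\<lambda>m. F m * G m) (n, n') (m, m')"
    using assms by (auto simp: hmat_block_def hmat_at_mult)
qed

lemma hmat_block_power:
  assumes "finite I" "finite I'" "\<forall>x y. A x y \<noteq> 0 \<longrightarrow> x \<in> I' \<and> y \<in> I'"
  shows "hmat_power (I \<times> I') (hmat_block I I' A F) k = hmat_block I I' A (\<lambda>m. F m ^ k)"
  by (induction k) (simp_all add: hmat_block_1 hmat_block_mult[OF assms])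

lemma hmat_block_compose:
  assumes "finite I" "finite I'" "\<forall>x y. A x y \<noteq> 0 \<longrightarrow> x \<in> I' \<and> y \<in> I'"
  shows "hmat_compose (I \<times> I') f (hmat_block I I' A F) = hmat_block I I' A (\<lambda>m. f oo F m)"
  unfolding hmat_compose_def hmat_block_power[OF assms]
  by (intro ext fps_ext)
    (auto simp: hmat_block_def hmat_at_def fps_compose_nth sum_distrib_right mult.assoc)

section \<open>The twist and its inverse\<close>

lemma J_plus_supp: "\<forall>x y. J_plus j x y \<noteq> 0 \<longrightarrow> x \<in> weights j \<and> y \<in> weights j"
  by (auto simp: J_plus_def split: if_splits)

text \<open>On the block of weight \<open>m\<close> the exponent is -(1/2)(2m) sigma = m ln(1 - 2 h
  J_+), so the twist acts there as (1 - 2 h J_+)^m.\<close>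

lemma twist_eq_block:
  "twist j j' = hmat_block (weights j) (weights j') (J_plus j') fps_binomial"
proof -
  have "(\<lambda>x y. fps_const (- 1 / 2) *
        hmat_tensor (\<lambda>n m. fps_const (J_zero j n m)) (sigma_spin j') x y)
    = hmat_block (weights j) (weights j') (J_plus j') (\<lambda>m. fps_const m * fps_ln 1)"
    unfolding sigma_spin_def hmat_compose_monom
    by (intro ext fps_ext)
      (auto simp: hmat_tensor_def hmat_block_def J_zero_def hmat_at_def fps_mult_left_const_nth mult.assoc)
  then show ?thesis
    unfolding twist_def
    using fps_exp_oo_ln[of 1]
    by (simp add: hmat_block_compose[OF finite_weights finite_weights J_plus_supp])
qed

lemma twist_inv_eq:
  "twist_inv j j' n n' m m' = (if m \<in> weights j \<and> n = m
     then hmat_at (weights j') (J_plus j') (fps_binomial (- m)) n' m' else 0)"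
proof -
  let ?B = "hmat_block (weights j) (weights j') (J_plus j')"
  have inv: "fps_binomial m * fps_binomial (- m) = (1 :: real fps)" for m
    using fps_binomial_add_mult[of m "- m"] by simp
  have "hmat_inverse (weights j \<times> weights j') (twist j j') = ?B (\<lambda>m. fps_binomial (- m))"
  proof (rule hmat_inverse_eqI)
    fix x y assume nz: "?B (\<lambda>m. fps_binomial (- m)) x y \<noteq> 0"
    obtain n n' m m' where xy: "x = (n, n')" "y = (m, m')" by fastforce
    have m: "m \<in> weights j" "n = m" and "hmat_at (weights j') (J_plus j') (fps_binomial (- m)) n' m' \<noteq> 0"
      using nz by (auto simp: xy hmat_block_def split: if_splits)
    then obtain i where "mat_power (weights j') (J_plus j') i n' m' \<noteq> 0"
      by (auto simp: hmat_at_def fps_eq_iff)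
    then have "n' \<in> weights j'" "m' \<in> weights j'"
      using mat_power_supp[OF J_plus_supp] by blast+
    with m show "x \<in> weights j \<times> weights j' \<and> y \<in> weights j \<times> weights j'" by (simp add: xy)
  qed (simp_all add: finite_weights twist_eq_block hmat_block_mult J_plus_supp inv hmat_block_1
        mult.commute[of "fps_binomial (- _)"])
  then show ?thesis by (simp add: twist_inv_def hmat_block_def)
qed

text \<open>Left multiplication by \<open>b\<close> is the sum of two commuting operators, the
  commutator with \<open>b\<close> and right multiplication by \<open>b\<close>; this is its
  binomial expansion.\<close>

lemma power_mult_commutator:
  fixes b x :: "'w::real_algebra_1"
  shows "b ^ N * x = (\<Sum>i\<le>N. real (N choose i) *\<^sub>R (((\<lambda>y. b * y - y * b) ^^ i) x * b ^ (N - i)))"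
proof (induction N)
  case (Suc N)
  let ?D = "\<lambda>y. b * y - y * b"
  have "b ^ Suc N * x = (\<Sum>i\<le>N. real (N choose i) *\<^sub>R (b * ((?D ^^ i) x * b ^ (N - i))))"
    by (simp add: mult.assoc Suc.IH sum_distrib_left)
  also have "\<dots> = (\<Sum>i\<le>N. real (N choose i) *\<^sub>R
      ((?D ^^ i) x * b ^ Suc (N - i) + (?D ^^ Suc i) x * b ^ (N - i)))"
    by (intro sum.cong refl arg_cong[where f = "scaleR _"]) (simp add: algebra_simps)
  also have "\<dots> = (\<Sum>i\<le>Suc N. real (Suc N choose i) *\<^sub>R ((?D ^^ i) x * b ^ (Suc N - i)))"
    by (subst sum_choose_Suc[where f = "\<lambda>k i. (?D ^^ i) x * b ^ k"]) (rule refl)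
  finally show ?case .
qed simp

section \<open>The product law\<close>

lemma weightsE:
  assumes "m \<in> weights j"
  obtains q p where "j + m = real q" "j - m = real p" "2 * j = real (q + p)"
proof -
  obtain p q where "j - m = real p" "j + m = real q"
    using assms by (auto simp: weights_def elim!: Nats_cases)
  then show thesis using that[of q p] by simp
qed

lemma symplecton_eq_weyl:
  assumes q: "j + m = real q" and p: "j - m = real p"
  shows "symplecton a abar j m = sqrt (fact (q + p) / (fact q * fact p)) *\<^sub>R weyl a abar q p"
proof -
  have jj: "2 * j = real (q + p)" using q p by simp
  have c: "1 / (fact s * fact (p - s)) = real (p choose s) / fact p" if "s \<le> p" for s
    using that by (simp add: binomial_fact)
  have "(\<Sum>s = 0..p. (1 / (fact s * fact (p - s))) *\<^sub>R (abar ^ (p - s) * a ^ q * abar ^ s))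
     = (1 / fact p) *\<^sub>R (\<Sum>s\<le>p. real (p choose s) *\<^sub>R (abar ^ (p - s) * a ^ q * abar ^ s))"
    unfolding scaleR_sum_right atLeast0AtMost by (rule sum.cong) (simp_all add: c)
  also have "\<dots> = (2 ^ p / fact p) *\<^sub>R weyl a abar q p"
    unfolding weyl_conv_sum by simp
  finally have "symplecton a abar j m =
      (1 / 2 ^ p * sqrt (fact (q + p) * fact p / fact q) * (2 ^ p / fact p)) *\<^sub>R weyl a abar q p"
    unfolding symplecton_def Let_def q p jj rfact_of_nat by (simp add: powr_realpow)
  also have "1 / 2 ^ p * sqrt (fact (q + p) * fact p / fact q) * (2 ^ p / fact p) =
      sqrt (fact (q + p) * fact p / fact q) / sqrt ((fact p)\<^sup>2)"
    by simp
  also have "\<dots> = sqrt (fact (q + p) * fact p / fact q / (fact p)\<^sup>2)"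
    by (rule real_sqrt_divide[symmetric])
  also have "fact (q + p) * fact p / fact q / (fact p)\<^sup>2 = (fact (q + p) / (fact q * fact p) :: real)"
    by (simp add: power2_eq_square)
  finally show ?thesis .
qed

lemma mat_power_J_plus_shift:
  "mat_power (weights j) (J_plus j) i n m \<noteq> 0 \<Longrightarrow> n = m + real i"
proof (induction i arbitrary: n)
  case 0
  then show ?case by (auto split: if_splits)
next
  case (Suc i)
  then obtain z where "z \<in> weights j" "J_plus j n z * mat_power (weights j) (J_plus j) i z m \<noteq> 0"
    by (auto elim: sum.not_neutral_contains_not_neutral)
  then have "z = m + real i" "J_plus j n z \<noteq> 0" using Suc.IH[of z] by auto
  then show ?case by (auto simp: J_plus_def split: if_splits)
qed

section \<open>Commutators and products of symplectons\<close>

context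
  fixes a abar :: "'w::real_algebra_1"
  assumes boson: "abar * a - a * abar = 1"
begin

abbreviation "Psym \<equiv> symplecton a abar"

text \<open>The root in \<open>symplecton_eq_weyl\<close> is the normalization that turns the
  integer factor of \<open>a_sq_commutator_weyl\<close> into the matrix element of
  \<open>J_plus\<close>.\<close>

lemma a_sq_commutator_symplecton:
  assumes m: "m \<in> weights j"
  shows "a ^ 2 * Psym j m - Psym j m * a ^ 2 = (- 2) *\<^sub>R (\<Sum>n\<in>weights j. J_plus j n m *\<^sub>R Psym j n)"
proof -
  obtain q p where qp: "j + m = real q" "j - m = real p" "2 * j = real (q + p)" using weightsE[OF m] .
  have "a ^ 2 * Psym j m - Psym j m * a ^ 2 =
      sqrt (fact (q + p) / (fact q * fact p)) *\<^sub>R (a ^ 2 * weyl a abar q p - weyl a abar q p * a ^ 2)"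
    unfolding symplecton_eq_weyl[OF qp(1,2)] by (simp add: scaleR_diff_right)
  also have "\<dots> = (- 2) *\<^sub>R ((sqrt (fact (q + p) / (fact q * fact p)) * real p) *\<^sub>R weyl a abar (Suc q) (p - 1))"
    unfolding a_sq_commutator_weyl[OF boson] by (simp add: mult_ac)
  also have "(sqrt (fact (q + p) / (fact q * fact p)) * real p) *\<^sub>R weyl a abar (Suc q) (p - 1)
      = (\<Sum>n\<in>weights j. J_plus j n m *\<^sub>R Psym j n)"
  proof (cases p)
    case 0
    then have z: "J_plus j n m = 0" for n
      using qp by (auto simp: J_plus_def)
    show ?thesis using 0 by (simp add: z)
  next
    case (Suc l)
    have w: "m + 1 \<in> weights j" using weights_plus[OF m] qp Suc by simp
    have "(\<Sum>n\<in>weights j. J_plus j n m *\<^sub>R Psym j n) =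
        (\<Sum>n\<in>weights j. if n = m + 1 then sqrt ((j - m) * (j + m + 1)) *\<^sub>R Psym j (m + 1) else 0)"
      by (rule sum.cong) (auto simp: J_plus_def m)
    also have "\<dots> = sqrt ((j - m) * (j + m + 1)) *\<^sub>R Psym j (m + 1)"
      using w by (simp add: finite_weights)
    also have "Psym j (m + 1) = sqrt (fact (Suc q + l) / (fact (Suc q) * fact l)) *\<^sub>R weyl a abar (Suc q) l"
      by (rule symplecton_eq_weyl) (use qp Suc in auto)
    also have "sqrt ((j - m) * (j + m + 1)) *\<^sub>R (sqrt (fact (Suc q + l) / (fact (Suc q) * fact l)) *\<^sub>R weyl a abar (Suc q) l)
      = sqrt ((real (Suc l) * real (Suc q)) * (fact (Suc q + l) / (fact (Suc q) * fact l))) *\<^sub>R weyl a abar (Suc q) l"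
    proof -
      have "(j - m) * (j + m + 1) = real (Suc l) * real (Suc q)" using qp Suc by simp
      then show ?thesis by (simp only: scaleR_scaleR real_sqrt_mult)
    qed
    also have "(real (Suc l) * real (Suc q)) * (fact (Suc q + l) / (fact (Suc q) * fact l))
        = fact (q + p) / (fact q * fact p) * (real p)\<^sup>2"
      unfolding Suc fact_Suc add_Suc add_Suc_right of_nat_mult
      by (simp add: power2_eq_square del: of_nat_Suc of_nat_add)
    also have "sqrt (fact (q + p) / (fact q * fact p) * (real p)\<^sup>2) = sqrt (fact (q + p) / (fact q * fact p)) * real p"
      by (simp only: real_sqrt_mult real_sqrt_abs abs_of_nat)
    finally show ?thesis by (simp add: Suc)
  qed
  finally show ?thesis .
qed

lemma a_sq_commutator_iterate:
  assumes m: "m \<in> weights j"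
  shows "((\<lambda>y. a ^ 2 * y - y * a ^ 2) ^^ i) (Psym j m) =
    (- 2) ^ i *\<^sub>R (\<Sum>n\<in>weights j. mat_power (weights j) (J_plus j) i n m *\<^sub>R Psym j n)"
proof (induction i)
  case 0
  have "(\<Sum>n\<in>weights j. mat_power (weights j) (J_plus j) 0 n m *\<^sub>R Psym j n) =
      (\<Sum>n\<in>weights j. if n = m then Psym j m else 0)"
    by (rule sum.cong) auto
  then show ?case using m by (simp add: finite_weights)
next
  case (Suc i)
  let ?M = "mat_power (weights j) (J_plus j)"
  let ?D = "\<lambda>y. a ^ 2 * y - y * a ^ 2"
  have "(?D ^^ Suc i) (Psym j m) = (- 2) ^ i *\<^sub>R (\<Sum>z\<in>weights j. ?M i z m *\<^sub>R ?D (Psym j z))"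
    by (simp add: Suc.IH sum_distrib_left sum_distrib_right sum_subtractf scaleR_diff_right)
  also have "\<dots> = (- 2) ^ i *\<^sub>R (\<Sum>z\<in>weights j. ?M i z m *\<^sub>R ((- 2) *\<^sub>R (\<Sum>n\<in>weights j. J_plus j n z *\<^sub>R Psym j n)))"
    by (intro arg_cong[where f = "scaleR _"] sum.cong refl) (simp only: a_sq_commutator_symplecton)
  also have "\<dots> = (- 2) ^ Suc i *\<^sub>R (\<Sum>z\<in>weights j. \<Sum>n\<in>weights j. (J_plus j n z * ?M i z m) *\<^sub>R Psym j n)"
    by (simp add: scaleR_sum_right mult_ac)
  also have "(\<Sum>z\<in>weights j. \<Sum>n\<in>weights j. (J_plus j n z * ?M i z m) *\<^sub>R Psym j n)
     = (\<Sum>n\<in>weights j. \<Sum>z\<in>weights j. (J_plus j n z * ?M i z m) *\<^sub>R Psym j n)"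
    by (rule sum.swap)
  finally show ?case by (simp add: scaleR_sum_left)
qed

text \<open>Moving \<open>e\<^bsup>m \<sigma>\<^esup>\<close> past a symplecton is what produces the twist, since \<open>a\<^sup>2 = - 2 J\<^sub>+\<close> acts by
  commutators as \<open>J\<^sub>+\<close> does in the spin-\<open>j'\<close> representation.\<close>

lemma exp_sigma_symplecton:
  assumes m': "m' \<in> weights j'"
  shows "fps_at (a ^ 2) (fps_binomial (- m)) * fps_const (Psym j' m') =
    (\<Sum>n'\<in>weights j'. of_real_fps (hmat_at (weights j') (J_plus j') (fps_binomial (- m)) n' m') *
       fps_const (Psym j' n') * fps_at (a ^ 2) (fps_binomial (- m - (n' - m'))))"
proof (rule fps_ext)
  fix N
  let ?M = "mat_power (weights j') (J_plus j')"
  let ?c = "\<lambda>i n'. ((- m) gchoose N) * real (N choose i) * ((- 2) ^ i * ?M i n' m')"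
  have "(fps_at (a ^ 2) (fps_binomial (- m)) * fps_const (Psym j' m')) $ N = ((- m) gchoose N) *\<^sub>R ((a ^ 2) ^ N * Psym j' m')"
    by (simp add: fps_at_nth)
  also have "\<dots> = ((- m) gchoose N) *\<^sub>R (\<Sum>i\<le>N. real (N choose i) *\<^sub>R
      (((- 2) ^ i *\<^sub>R (\<Sum>n'\<in>weights j'. ?M i n' m' *\<^sub>R Psym j' n')) * (a ^ 2) ^ (N - i)))"
    unfolding power_mult_commutator[of "a ^ 2" N] a_sq_commutator_iterate[OF m'] ..
  also have "\<dots> = (\<Sum>i\<le>N. \<Sum>n'\<in>weights j'. ?c i n' *\<^sub>R (Psym j' n' * (a ^ 2) ^ (N - i)))"
    by (simp add: scaleR_sum_right sum_distrib_right mult_ac)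
  also have "\<dots> = (\<Sum>n'\<in>weights j'. \<Sum>i\<le>N. ?c i n' *\<^sub>R (Psym j' n' * (a ^ 2) ^ (N - i)))"
    by (rule sum.swap)
  also have "\<dots> = (\<Sum>n'\<in>weights j'. \<Sum>i\<le>N. (((- m) gchoose i) * ((- 2) ^ i * ?M i n' m') * ((- m - (n' - m')) gchoose (N - i)))
      *\<^sub>R (Psym j' n' * (a ^ 2) ^ (N - i)))"
  proof (intro sum.cong refl arg_cong2[where f = scaleR])
    fix n' i assume "i \<in> {..N}"
    \<comment> \<open>Trinomial revision separates the coefficient belonging to the matrix from that
      belonging to \<open>a ^ 2\<close>, which turns the sum into a Cauchy product.\<close>
    then have "((- m) gchoose N) * real (N choose i) = ((- m) gchoose i) * ((- m - real i) gchoose (N - i))"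
      using gbinomial_trinomial_revision[of i N "- m"] by (simp add: binomial_gbinomial)
    \<comment> \<open>The \<open>i\<close>-th power of \<open>J_plus\<close> connects only weights
      differing by \<open>i\<close>. So \<open>i\<close> in the second upper index can be replaced
      by \<open>n' - m'\<close>, which is fixed in the sum over \<open>i\<close>.\<close>
    moreover have "?M i n' m' = 0 \<or> n' - m' = real i"
    proof (cases "?M i n' m' = 0")
      case False
      from mat_power_J_plus_shift[OF this] show ?thesis by simp
    qed simp
    ultimately show "?c i n' = ((- m) gchoose i) * ((- 2) ^ i * ?M i n' m') * ((- m - (n' - m')) gchoose (N - i))"
      by auto
  qed
  also have "\<dots> = (\<Sum>n'\<in>weights j'. of_real_fps (hmat_at (weights j') (J_plus j') (fps_binomial (- m)) n' m') *
       fps_const (Psym j' n') * fps_at (a ^ 2) (fps_binomial (- m - (n' - m')))) $ N"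
    unfolding fps_sum_nth mult.assoc fps_mult_nth[of "of_real_fps _"]
    by (intro sum.cong refl)
      (simp_all add: hmat_at_def fps_at_nth atLeast0AtMost of_real_def mult_ac)
  finally show "(fps_at (a ^ 2) (fps_binomial (- m)) * fps_const (Psym j' m')) $ N = \<dots>" .
qed

text \<open>The spin \<open>k\<close> collects the contractions of order
  \<open>r = j + j' - k\<close>; no more are possible than either factor has letters,
  \<open>2 * j\<close> and \<open>2 * j'\<close>, which reproduces the range of
  \<open>k\<close>.\<close>

lemma symplecton_mult:
  assumes m: "m \<in> weights j" and m': "m' \<in> weights j'"
  shows "Psym j m * Psym j' m' = (\<Sum>k\<in>{k. k - \<bar>j - j'\<bar> \<in> \<nat> \<and> j + j' - k \<in> \<nat>}.
    (sqrt (rfact (2 * j) * rfact (2 * j') / rfact (2 * k)) * reduced_coeff k j j'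
      * clebsch_gordan j' j k m' m (m' + m)) *\<^sub>R Psym k (m' + m))"
proof -
  obtain q p where qp: "j + m = real q" "j - m = real p" "2 * j = real (q + p)" using weightsE[OF m] .
  obtain q' p' where qp': "j' + m' = real q'" "j' - m' = real p'" "2 * j' = real (q' + p')" using weightsE[OF m'] .
  let ?E = "\<lambda>r. racah_sum r (real q') (real p') (real q) (real p)"
  let ?A = "fact q' * fact p' * fact q * fact p :: real"
  let ?n = "min (q + p) (q' + p')"
  let ?g = "\<lambda>r. j + j' - real r"
  let ?K = "{k. k - \<bar>j - j'\<bar> \<in> \<nat> \<and> j + j' - k \<in> \<nat>}"
  have K: "?K = ?g ` {..?n}"
  proof (intro equalityI subsetI)
    fix k assume "k \<in> ?K"
    then obtain r s where rs: "j + j' - k = real r" "k - \<bar>j - j'\<bar> = real s" by (auto elim!: Nats_cases)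
    then have "real r \<le> real ?n" using qp(3) qp'(3) by (auto simp: min_def)
    then have "r \<le> ?n" by linarith
    then show "k \<in> ?g ` {..?n}" using rs by (intro image_eqI[of _ _ r]) auto
  next
    fix k assume "k \<in> ?g ` {..?n}"
    then obtain r where r: "r \<le> ?n" "k = ?g r" by auto
    have "k - \<bar>j - j'\<bar> = real (?n - r)"
    proof (cases "q + p \<le> q' + p'")
      case True
      then have "j \<le> j'" using qp(3) qp'(3) by linarith
      then show ?thesis using r qp(3) True by (simp add: of_nat_diff)
    next
      case False
      then have "j \<ge> j'" using qp(3) qp'(3) by linarith
      then show ?thesis using r qp'(3) False by (simp add: of_nat_diff)
    qed
    moreover have "j + j' - k = real r" using r by simp
    ultimately show "k \<in> ?K" by (simp only: mem_Collect_eq of_nat_in_Nats simp_thms)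
  qed
  have "Psym j m * Psym j' m' = (sqrt (fact (q + p) / (fact q * fact p)) * sqrt (fact (q' + p') / (fact q' * fact p')))
      *\<^sub>R (weyl a abar q p * weyl a abar q' p')"
    unfolding symplecton_eq_weyl[OF qp(1,2)] symplecton_eq_weyl[OF qp'(1,2)] by simp
  also have "weyl a abar q p * weyl a abar q' p' = (\<Sum>r\<le>q' + p'. (?A / 2 ^ r * ?E r) *\<^sub>R weyl a abar (q' + q - r) (p' + p - r))"
    by (rule weyl_mult[OF boson]) simp
  also have "\<dots> = (\<Sum>r\<le>?n. (?A / 2 ^ r * ?E r) *\<^sub>R weyl a abar (q' + q - r) (p' + p - r))"
    by (rule sum.mono_neutral_right) (auto simp: racah_sum_eq_0)
  also have "(sqrt (fact (q + p) / (fact q * fact p)) * sqrt (fact (q' + p') / (fact q' * fact p'))) *\<^sub>R \<dots> =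
      (\<Sum>r\<le>?n. (sqrt (rfact (2 * j) * rfact (2 * j') / rfact (2 * ?g r)) * reduced_coeff (?g r) j j'
      * clebsch_gordan j' j (?g r) m' m (m' + m)) *\<^sub>R Psym (?g r) (m' + m))"
    unfolding scaleR_sum_right
  proof (rule sum.cong[OF refl])
    fix r assume "r \<in> {..?n}"
    then have r: "r \<le> q + p" "r \<le> q' + p'" by auto
    show "(sqrt (fact (q + p) / (fact q * fact p)) * sqrt (fact (q' + p') / (fact q' * fact p'))) *\<^sub>R
      ((?A / 2 ^ r * ?E r) *\<^sub>R weyl a abar (q' + q - r) (p' + p - r)) =
      (sqrt (rfact (2 * j) * rfact (2 * j') / rfact (2 * ?g r)) * reduced_coeff (?g r) j j'
      * clebsch_gordan j' j (?g r) m' m (m' + m)) *\<^sub>R Psym (?g r) (m' + m)"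
    proof (cases "r \<le> q' + q \<and> r \<le> p' + p")
      \<comment> \<open>If \<open>r\<close> exceeds the total exponent of \<open>a\<close> or of
        \<open>abar\<close>, the weight \<open>m' + m\<close> does not occur in spin
        \<open>?g r\<close>, and both sides vanish.\<close>
      case False
      then have "?E r = 0" by (intro racah_sum_eq_0) auto
      moreover have "m' + m \<notin> weights (?g r)"
      proof
        assume "m' + m \<in> weights (?g r)"
        then obtain x y where "?g r + (m' + m) = real x" "?g r - (m' + m) = real y" by (elim weightsE)
        then have "real q' + real q = real x + real r" "real p' + real p = real y + real r"
          using qp qp' by linarith+
        then show False using False by linarith
      qed
      ultimately show ?thesis by (simp add: clebsch_gordan_def)
    next
      case True
      define k N P where "k = ?g r" and "N = q' + q - r" and "P = p' + p - r"
      have kN: "k + (m' + m) = real N" and kP: "k - (m' + m) = real P"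
        using True qp qp' by (auto simp: k_def N_def P_def of_nat_diff)
      then have w: "m' + m \<in> weights k" by (simp add: weights_def)
      have k2: "2 * k = real (N + P)" using kN kP by simp
      have tri: "2 * j' = real (r + (q' + p' - r))" "2 * j = real (r + (q + p - r))"
        "2 * k = real ((q' + p' - r) + (q + p - r))"
        using r qp(3) qp'(3) by (auto simp: k_def of_nat_diff)
      have kr: "k - j - j' = - real r" "j' + j - k = real r" by (auto simp: k_def)
      have nab: "nabla k j j' > 0" by (simp add: nabla_def rfact_pos)
      have k0: "2 * k + 1 > 0" unfolding k2 by simp
      \<comment> \<open>The factors \<open>nabla\<close> and \<open>2 * k + 1\<close> cancel against
        the normalization of the Racah vector; the power of 2 left over is the weight of
        \<open>r\<close> contractions.\<close>
      have "reduced_coeff k j j' * clebsch_gordan j' j k m' m (m' + m) =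
         2 powr (- real r) * ((2 * k + 1) powr (- 1 / 2) * sqrt (2 * k + 1)) * racah_vec j' j k (m' + m) (m', m)"
        unfolding clebsch_gordan_eq[OF tri w] reduced_coeff_def kr using nab by simp
      also have "(2 * k + 1) powr (- 1 / 2) * sqrt (2 * k + 1) = 1"
        using k0 by (simp add: powr_half_sqrt[symmetric] powr_add[symmetric])
      also have "2 powr (- real r) = 1 / 2 ^ r"
        by (simp add: powr_minus powr_realpow divide_inverse)
      also have "racah_vec j' j k (m' + m) (m', m) = sqrt (?A * (fact N * fact P)) * ?E r"
        using m m' by (simp add: racah_vec_def qp qp' kN kP kr mult_ac)
      finally have rc: "reduced_coeff k j j' * clebsch_gordan j' j k m' m (m' + m) =
         sqrt (?A * (fact N * fact P)) * ?E r / 2 ^ r" by simp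
      \<comment> \<open>Here the square root factor of the product law arises:
        \<open>fact (q + p)\<close> and \<open>fact (q' + p')\<close> are (2j)! and (2j')! from the
        two factors, and \<open>fact (N + P)\<close> is (2k)!, compensating the normalization of
        \<open>Psym k (m' + m)\<close>.\<close>
      have "sqrt (fact (q + p) * fact (q' + p') / fact (N + P)) * sqrt (?A * (fact N * fact P)) * sqrt (fact (N + P) / (fact N * fact P))
        = sqrt (fact (q + p) / (fact q * fact p)) * sqrt (fact (q' + p') / (fact q' * fact p')) * sqrt (?A\<^sup>2)"
        unfolding real_sqrt_mult[symmetric] by (simp add: power2_eq_square)
      then have co: "sqrt (fact (q + p) * fact (q' + p') / fact (N + P)) * (sqrt (?A * (fact N * fact P)) * ?E r / 2 ^ r)
          * sqrt (fact (N + P) / (fact N * fact P))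
        = sqrt (fact (q + p) / (fact q * fact p)) * sqrt (fact (q' + p') / (fact q' * fact p')) * (?A / 2 ^ r * ?E r)"
        by (simp add: mult_ac)
      show ?thesis
        unfolding k_def[symmetric] N_def[symmetric] P_def[symmetric] symplecton_eq_weyl[OF kN kP]
          mult.assoc[of _ "reduced_coeff k j j'"] rc scaleR_scaleR co[symmetric] k2 qp(3) qp'(3) rfact_of_nat ..
    qed
  qed
  also have "\<dots> = (\<Sum>k\<in>?K. (sqrt (rfact (2 * j) * rfact (2 * j') / rfact (2 * k)) * reduced_coeff k j j'
      * clebsch_gordan j' j k m' m (m' + m)) *\<^sub>R Psym k (m' + m))"
    unfolding K by (subst sum.reindex) (auto intro!: inj_onI)
  finally show ?thesis .
qed

end

lemma of_real_fps_mult_const: "of_real_fps (f * fps_const c) = of_real_fps f * fps_const (of_real c)"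
  by (rule fps_ext) (simp add: fps_mult_right_const_nth)

lemma of_real_fps_commute: "of_real_fps f * g = g * of_real_fps f"
proof (rule fps_ext)
  fix n
  have "(of_real_fps f * g) $ n = (\<Sum>i=0..n. of_real (f $ (n - i)) * g $ i)"
    unfolding fps_mult_nth by (subst sum.atLeastAtMost_rev) simp
  then show "(of_real_fps f * g) $ n = (g * of_real_fps f) $ n"
    by (simp add: fps_mult_nth of_real_def)
qed

theorem theorem6p1:
  fixes a abar :: "'w::real_algebra_1" and j j' m m' :: real
  assumes boson: "abar * a - a * abar = 1"
    and spins: "2 * j \<in> \<nat>" "2 * j' \<in> \<nat>"
    and wts: "m \<in> weights j" "m' \<in> weights j'"
  shows "h_symplecton a abar j m * h_symplecton a abar j' m' =
    (\<Sum>k\<in>{k. k - \<bar>j - j'\<bar> \<in> \<nat> \<and> j + j' - k \<in> \<nat>}. \<Sum>n\<in>weights j. \<Sum>n'\<in>weights j'.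
       of_real_fps
         (fps_const (sqrt (rfact (2 * j) * rfact (2 * j') / rfact (2 * k))) *
          fps_const (reduced_coeff k j j') * twist_inv j j' n n' m m' *
          fps_const (clebsch_gordan j' j k n' m (n' + m))) *
       h_symplecton a abar k (n' + m))"
proof -
  let ?K = "{k. k - \<bar>j - j'\<bar> \<in> \<nat> \<and> j + j' - k \<in> \<nat>}"
  let ?t = "\<lambda>n'. of_real_fps (hmat_at (weights j') (J_plus j') (fps_binomial (- m)) n' m') :: 'w fps"
  let ?s = "\<lambda>x. fps_at (a ^ 2) (fps_binomial x)"
  let ?P = "symplecton a abar"
  let ?c = "\<lambda>k n'. sqrt (rfact (2 * j) * rfact (2 * j') / rfact (2 * k)) * reduced_coeff k j j'
      * clebsch_gordan j' j k n' m (n' + m)"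
  have s_add: "?s x * ?s y = ?s (x + y)" for x y
    by (simp add: fps_at_mult[symmetric] fps_binomial_add_mult)
  have "h_symplecton a abar j m * h_symplecton a abar j' m' =
      fps_const (?P j m) * (?s (- m) * fps_const (?P j' m')) * ?s (- m')"
    by (simp add: h_symplecton_def exp_sigma_boson mult.assoc)
  also have "\<dots> = (\<Sum>n'\<in>weights j'. fps_const (?P j m) * (?t n' * fps_const (?P j' n') * ?s (- m - (n' - m'))) * ?s (- m'))"
    unfolding exp_sigma_symplecton[OF boson wts(2)] sum_distrib_left sum_distrib_right ..
  also have "\<dots> = (\<Sum>n'\<in>weights j'. \<Sum>k\<in>?K. ?t n' * fps_const (?c k n' *\<^sub>R ?P k (n' + m)) * ?s (- (n' + m)))"
  proof (rule sum.cong[OF refl])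
    fix n' assume n': "n' \<in> weights j'"
    have "fps_const (?P j m) * (?t n' * fps_const (?P j' n') * ?s (- m - (n' - m'))) * ?s (- m')
      = (fps_const (?P j m) * ?t n') * fps_const (?P j' n') * (?s (- m - (n' - m')) * ?s (- m'))"
      by (simp only: mult.assoc)
    \<comment> \<open>The exponents \<open>- m - (n' - m')\<close> and \<open>- m'\<close> add up to
      \<open>- (n' + m)\<close>, as \<open>h_symplecton a abar k (n' + m)\<close> requires.\<close>
    also have "\<dots> = ?t n' * fps_const (?P j m * ?P j' n') * ?s (- (n' + m))"
      unfolding s_add of_real_fps_commute[symmetric] by (simp add: mult.assoc add.commute flip: fps_const_mult)
    also have "fps_const (?P j m * ?P j' n') = (\<Sum>k\<in>?K. fps_const (?c k n' *\<^sub>R ?P k (n' + m)))"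
      unfolding symplecton_mult[OF boson wts(1) n'] by (rule fps_ext) (simp add: fps_sum_nth)
    finally show "fps_const (?P j m) * (?t n' * fps_const (?P j' n') * ?s (- m - (n' - m'))) * ?s (- m')
      = (\<Sum>k\<in>?K. ?t n' * fps_const (?c k n' *\<^sub>R ?P k (n' + m)) * ?s (- (n' + m)))"
      by (simp only: sum_distrib_left sum_distrib_right)
  qed
  also have "\<dots> = (\<Sum>k\<in>?K. \<Sum>n'\<in>weights j'. ?t n' * fps_const (?c k n' *\<^sub>R ?P k (n' + m)) * ?s (- (n' + m)))"
    by (rule sum.swap)
  \<comment> \<open>The twist is diagonal in its first tensor factor, so the sum over
    \<open>n\<close> enters as a Kronecker delta.\<close>
  also have "\<dots> = (\<Sum>k\<in>?K. \<Sum>n\<in>weights j. if n = m then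
      \<Sum>n'\<in>weights j'. ?t n' * fps_const (?c k n' *\<^sub>R ?P k (n' + m)) * ?s (- (n' + m)) else 0)"
    using wts(1) by (simp add: finite_weights)
  also have "\<dots> = (\<Sum>k\<in>?K. \<Sum>n\<in>weights j. \<Sum>n'\<in>weights j'.
       of_real_fps
         (fps_const (sqrt (rfact (2 * j) * rfact (2 * j') / rfact (2 * k))) *
          fps_const (reduced_coeff k j j') * twist_inv j j' n n' m m' *
          fps_const (clebsch_gordan j' j k n' m (n' + m))) *
       h_symplecton a abar k (n' + m))"
  proof (intro sum.cong refl)
    fix k n assume "k \<in> ?K" "n \<in> weights j"
    show "(if n = m then \<Sum>n'\<in>weights j'. ?t n' * fps_const (?c k n' *\<^sub>R ?P k (n' + m)) * ?s (- (n' + m)) else 0)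
      = (\<Sum>n'\<in>weights j'. of_real_fps
         (fps_const (sqrt (rfact (2 * j) * rfact (2 * j') / rfact (2 * k))) *
          fps_const (reduced_coeff k j j') * twist_inv j j' n n' m m' *
          fps_const (clebsch_gordan j' j k n' m (n' + m))) *
       h_symplecton a abar k (n' + m))"
    proof (cases "n = m")
      case False
      then show ?thesis by (simp add: twist_inv_eq of_real_fps_def fps_zero_def[symmetric])
    next
      case True
      have "of_real_fps (fps_const x * fps_const y * f * fps_const z) * (fps_const p * g)
        = of_real_fps f * fps_const ((x * y * z) *\<^sub>R p) * g" for x y z f g and p :: 'w
      proof -
        have "fps_const x * fps_const y * f * fps_const z = f * fps_const (x * y * z)"
          by (simp only: mult_ac fps_const_mult[symmetric])
        then have eq: "of_real_fps (fps_const x * fps_const y * f * fps_const z) = of_real_fps f * fps_const (of_real (x * y * z))"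
          by (simp only: of_real_fps_mult_const)
        show ?thesis
          unfolding eq by (simp only: scaleR_conv_of_real fps_const_mult[symmetric] mult.assoc)
      qed
      then show ?thesis using True wts(1) by (simp add: twist_inv_eq h_symplecton_def exp_sigma_boson)
    qed
  qed
  finally show ?thesis .
qed

end
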